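(* Let $q$ be a power of $2$. Let $G_1\le O^+(2m,q)$ be the group of all matrices $N=\begin{pmatrix}A&0&0\\ B&I_2&0\\ C&D&E\end{pmatrix}\in U(2m,\mathbb{F}_q)$, with $A,E\in U(m-1,\mathbb{F}_q)$, such that $N^TJ_{2m}N=J_{2m}$ and $S=A^TJ_{m-1}C$ satisfies $s_{ii}=b_{1i}b_{2i}$ for $i=1,\dots,m-1$. Let $L=\begin{pmatrix}I_{m-1}&0&0\\ 0&J_2&0\\ 0&0&I_{m-1}\end{pmatrix}$ and let $G=\langle G_1,L\rangle$, a Sylow $p$-subgroup ($p=2$) of $O^+(2m,q)$. Let $h_1=\sum_{i=1}^mx_{2m-i+1}x_i$ and, for $k\ge2$, $h_k=\sum_{i=1}^m\left(x_{2m-i+1}^{q^{k-1}}x_i+x_{2m-i+1}x_i^{q^{k-1}}\right)$. Then $\mathbb{F}_q(V)^G$ is generated over $\mathbb{F}_q$ by the polynomials $$N(x_1)=x_1,\ N(x_2),\dots,N(x_{m-1}),\ N(x_m)+N(x_{m+1}),\ N(x_m)N(x_{m+1}),\ h_1,\dots,h_{m-1},$$ where $N(x_i)$ denotes the $G_1$-orbit product of $x_i$. (The first group of generators is $N(x_i)$ for $1\le i\le m-1$.)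
   Context: $m\ge 1$, $V=\mathbb{F}_q^{2m}$ (column vectors) with $x_1,\dots,x_{2m}$ the dual basis of the standard basis; $\mathbb{F}_q[V]=\mathbb{F}_q[x_1,\dots,x_{2m}]$, $\mathbb{F}_q(V)$ is its fraction field, and matrix groups act by $(g\cdot f)(v)=f(g^{-1}v)$. The $G_1$-orbit product is $N(x_i)=\prod_{y\in G_1\cdot x_i}y$. $U(n,\mathbb{F})$ is the group of lower triangular $n\times n$ matrices over $\mathbb{F}$ with ones on the diagonal; $J_n$ is the $n\times n$ matrix with ones on the antidiagonal and zeros elsewhere; $b_{ij}$, $s_{ij}$ are the entries of the $2\times(m-1)$ matrix $B$ and of $S$ (blocks of size $0$ are omitted). $O^+(2m,q)$ is the group of invertible matrices preserving the quadratic form $\sum_{i=1}^mx_{2m-i+1}x_i$ on $V$. *)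

theory Defs
  imports
    "Jordan_Normal_Form.Matrix"
    "HOL-Library.Poly_Mapping"
    "HOL-Computational_Algebra.Fraction_Field"
    "HOL-Algebra.Generated_Groups"
    "HOL-Algebra.Generated_Fields"
    "HOL-Algebra.Algebraic_Closure_Type"
begin

text \<open>
  Polynomials in countably many variables, indexed by natural numbers, as finitely supported
  functions from monomials to coefficients. The ring $F[x_1,\dots,x_n]$ is the subset
  \<open>polys n\<close>, and its field of fractions is the subset \<open>rat_funs n\<close> of the field
  \<open>'a mpoly fract\<close>. Variables are numbered from 1, whereas the indices of matrices and vectors
  start at 0.
\<close>

type_synonym 'a mpoly = "(nat \<Rightarrow>\<^sub>0 nat) \<Rightarrow>\<^sub>0 'a"

definition const :: "'a::zero \<Rightarrow> 'a mpoly" where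
  "const c = Poly_Mapping.single 0 c"

definition Var :: "nat \<Rightarrow> 'a::zero_neq_one mpoly" where
  "Var i = Poly_Mapping.single (Poly_Mapping.single i 1) 1"

definition polys :: "nat \<Rightarrow> 'a::zero mpoly set" where
  "polys n = {p. \<forall>\<mu>\<in>Poly_Mapping.keys p. Poly_Mapping.keys \<mu> \<subseteq> {1..n}}"

definition to_rat :: "'a::idom mpoly \<Rightarrow> 'a mpoly fract" where
  "to_rat p = Fract p 1"

definition rat_funs :: "nat \<Rightarrow> 'a::idom mpoly fract set" where
  "rat_funs n = {Fract a b | a b. a \<in> polys n \<and> b \<in> polys n \<and> b \<noteq> 0}"

definition GL :: "nat \<Rightarrow> 'a::field mat monoid" where
  "GL n = units_of (ring_mat TYPE('a) n ())"

text \<open>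
  The action $(g \cdot f)(v) = f(g^{-1} v)$ on polynomials in $x_1,\dots,x_n$, where $n$ is the
  size of $g$: since $x_i(g^{-1} v)$ is the $i$-th entry of $g^{-1} v$, the matrix $g$ sends $x_i$
  to $\sum_j (g^{-1})_{ij} x_j$, and this extends to an algebra homomorphism. (Over a finite field
  a polynomial is not determined by its values, so the formula has to be read in this way.)
\<close>

definition act_var :: "'a::field mat \<Rightarrow> nat \<Rightarrow> 'a mpoly" where
  "act_var g i =
     (\<Sum>j = 1..dim_row g. const ((inv\<^bsub>GL (dim_row g)\<^esub> g) $$ (i - 1, j - 1)) * Var j)"

definition act_poly :: "'a::field mat \<Rightarrow> 'a mpoly \<Rightarrow> 'a mpoly" where
  "act_poly g p =
     (\<Sum>\<mu>\<in>Poly_Mapping.keys p. const (Poly_Mapping.lookup p \<mu>) *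
        (\<Prod>i\<in>Poly_Mapping.keys \<mu>. act_var g i ^ Poly_Mapping.lookup \<mu> i))"

text \<open>
  The induced action on rational functions in $x_1,\dots,x_n$. For an invertible $g$ the map
  \<open>act_poly g\<close> is an injective ring homomorphism on \<open>polys n\<close>, so the value does not depend on
  the chosen fraction.
\<close>

definition act_rat :: "'a::field mat \<Rightarrow> 'a mpoly fract \<Rightarrow> 'a mpoly fract" where
  "act_rat g f =
     (let (a, b) = (SOME (a, b). a \<in> polys (dim_row g) \<and> b \<in> polys (dim_row g) \<and>
                                 b \<noteq> 0 \<and> f = Fract a b)
      in Fract (act_poly g a) (act_poly g b))"

definition invariant_field :: "nat \<Rightarrow> 'a::field mat set \<Rightarrow> 'a mpoly fract set" where
  "invariant_field n H = {f \<in> rat_funs n. \<forall>g\<in>H. act_rat g f = f}"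

text \<open>The subfield generated over the constants by a set of polynomials.\<close>

definition field_generated :: "'a::field mpoly set \<Rightarrow> 'a mpoly fract set" where
  "field_generated P =
     generate_field (ring_of_type_algebra :: 'a mpoly fract ring) (to_rat ` (range const \<union> P))"

definition lower_unitri :: "nat \<Rightarrow> 'a::semiring_1 mat set" where
  "lower_unitri n =
     {A \<in> carrier_mat n n. (\<forall>i<n. A $$ (i, i) = 1) \<and> (\<forall>i<n. \<forall>j<n. i < j \<longrightarrow> A $$ (i, j) = 0)}"

definition antidiag_mat :: "nat \<Rightarrow> 'a::semiring_1 mat" where
  "antidiag_mat n = mat n n (\<lambda>(i, j). if i + j + 1 = n then 1 else 0)"

text \<open>The coordinate $x_i(v)$ is \<open>v $ (i - 1)\<close>, so $x_{2m-i+1}(v)$ is \<open>v $ (2 * m - i)\<close>.\<close>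

definition quad_form :: "nat \<Rightarrow> 'a::semiring_1 vec \<Rightarrow> 'a" where
  "quad_form m v = (\<Sum>i = 1..m. v $ (2 * m - i) * v $ (i - 1))"

definition O_plus :: "nat \<Rightarrow> 'a::field mat set" where
  "O_plus m = {g \<in> carrier (GL (2 * m)).
     \<forall>v \<in> carrier_vec (2 * m). quad_form m (g *\<^sub>v v) = quad_form m v}"

definition block_lower :: "nat \<Rightarrow> 'a::semiring_1 mat \<Rightarrow> 'a mat \<Rightarrow> 'a mat \<Rightarrow> 'a mat \<Rightarrow> 'a mat \<Rightarrow> 'a mat"
  where
  "block_lower m A B C D E =
     four_block_mat A (0\<^sub>m (m - 1) (m + 1))
       (B @\<^sub>r C) (four_block_mat (1\<^sub>m 2) (0\<^sub>m 2 (m - 1)) D E)"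

definition G1 :: "nat \<Rightarrow> 'a::field mat set" where
  "G1 m = {N \<in> O_plus m \<inter> lower_unitri (2 * m). \<exists>A B C D E.
      A \<in> lower_unitri (m - 1) \<and> B \<in> carrier_mat 2 (m - 1) \<and>
      C \<in> carrier_mat (m - 1) (m - 1) \<and> D \<in> carrier_mat (m - 1) 2 \<and>
      E \<in> lower_unitri (m - 1) \<and>
      N = block_lower m A B C D E \<and>
      N\<^sup>T * antidiag_mat (2 * m) * N = antidiag_mat (2 * m) \<and>
      (let S = A\<^sup>T * antidiag_mat (m - 1) * C
       in \<forall>i<m - 1. S $$ (i, i) = B $$ (0, i) * B $$ (1, i))}"

definition L_mat :: "nat \<Rightarrow> 'a::semiring_1 mat" where
  "L_mat m = diag_block_mat [1\<^sub>m (m - 1), antidiag_mat 2, 1\<^sub>m (m - 1)]"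

definition G_grp :: "nat \<Rightarrow> 'a::field mat set" where
  "G_grp m = generate (GL (2 * m)) (insert (L_mat m) (G1 m))"

definition orbit_prod :: "nat \<Rightarrow> nat \<Rightarrow> 'a::field mpoly" where
  "orbit_prod m i = (\<Prod>y\<in>(\<lambda>g. act_poly g (Var i)) ` G1 m. y)"

definition h_poly :: "nat \<Rightarrow> nat \<Rightarrow> nat \<Rightarrow> 'a::field mpoly" where
  "h_poly q m k =
     (if k = 1 then (\<Sum>i = 1..m. Var (2 * m - i + 1) * Var i)
      else (\<Sum>i = 1..m. Var (2 * m - i + 1) ^ (q ^ (k - 1)) * Var i
                      + Var (2 * m - i + 1) * Var i ^ (q ^ (k - 1))))"

end

theory Submission
  imports Defs "HOL-Computational_Algebra.Polynomial"
begin

text \<open>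
  Write \<open>i' = 2m + 1 - i\<close> and \<open>s_i = min i i' - 1\<close>, let \<open>W_s\<close> be the span of $x_1, \dots, x_s$ and
  $P_s(t) = \prod_{v \in W_s} (t + v)$. Let $K_i$ be generated by $N(x_1), \dots, N(x_{m+1})$,
  $h_1, \dots, h_{m-1}$ and $x_1, \dots, x_i$. Any $G_1$-invariant lies in $K_{2m}$, and a $G_1$-invariant
  in $K_i$ already lies in $K_{i-1}$: over $K_{i-1}$ the element $x_i$ is a root of
  $P_{s_i}(t) - P_{s_i}(x_i)$, of degree $|W_{s_i}|$, while elements of $G_1$ that fix
  $x_1, \dots, x_{i-1}$ move $x_i$ to all of $x_i + W_{s_i}$. That the constant term is in $K_{i-1}$
  is clear for $i \le m+1$, where it is $N(x_i)$. For $i > m+1$ one evaluates $h_1$ at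
  $(P_s(x_1), \dots, P_s(x_{2m}))$ with $s = s_i$: since $P_s$ is additive, the result is a combination of
  Frobenius powers of $h_1, \dots, h_{s+1}$, whereas all its terms $P_s(x_l) P_s(x_{l'})$ with $l < i'$ vanish,
  so it can be solved for $P_s(x_i)$. Finally $L$ swaps $N(x_m)$ and $N(x_{m+1})$, and the same
  argument applies to $N(x_m)$, of degree 2 over the field generated by the claimed generators.
\<close>

section \<open>Descent to a base field\<close>

text \<open>Neither minimal polynomials nor the order of \<open>G_1\<close> have to be known: a
  relation of degree d over the smaller field together with d distinct conjugates already forces a
  fixed element into that field. The conjugates come from explicit Siegel transformations, which
  move \<open>x_i\<close> by a prescribed element of \<open>W_s\<close> and fix all earlier
  variables. The obstacle lies in the variables after \<open>x_{m+1}\<close>: their orbit products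
  are not among the generators, so the relation has to be extracted from the forms h. The choice
  \<open>s = i' - 1\<close> makes \<open>P_s\<close> kill every variable before
  \<open>x_{i'}\<close> but not \<open>x_{i'}\<close> itself. In the evaluated form the pair
  \<open>(x_{i'}, x_i)\<close> is then the first one that survives, all later pairs involve only
  variables before \<open>x_i\<close>, and one can divide by \<open>P_s(x_{i'})\<close>. For
  \<open>i > m + 1\<close> one has \<open>s + 1 \<le> m - 1\<close>, which is why the list of forms
  can stop at \<open>h_{m-1}\<close>.\<close>

definition is_subfield :: "'b::Fields.field set \<Rightarrow> bool" where
  "is_subfield K \<longleftrightarrow> 1 \<in> K \<and> (\<forall>x\<in>K. \<forall>y\<in>K. x + y \<in> K \<and> x * y \<in> K) \<and>
     (\<forall>x\<in>K. - x \<in> K \<and> inverse x \<in> K)"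

abbreviation field_gen :: "'b::Fields.field set \<Rightarrow> 'b set" where
  "field_gen S \<equiv> generate_field ring_of_type_algebra S"

lemma
  assumes "is_subfield K"
  shows subfield_one: "1 \<in> K"
    and subfield_zero: "0 \<in> K"
    and subfield_add: "\<And>x y. x \<in> K \<Longrightarrow> y \<in> K \<Longrightarrow> x + y \<in> K"
    and subfield_mult: "\<And>x y. x \<in> K \<Longrightarrow> y \<in> K \<Longrightarrow> x * y \<in> K"
    and subfield_uminus: "\<And>x. x \<in> K \<Longrightarrow> - x \<in> K"
    and subfield_inverse: "\<And>x. x \<in> K \<Longrightarrow> inverse x \<in> K"
    and subfield_diff: "\<And>x y. x \<in> K \<Longrightarrow> y \<in> K \<Longrightarrow> x - y \<in> K"
    and subfield_divide: "\<And>x y. x \<in> K \<Longrightarrow> y \<in> K \<Longrightarrow> x / y \<in> K"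
proof -
  show one: "1 \<in> K" and add: "\<And>x y. x \<in> K \<Longrightarrow> y \<in> K \<Longrightarrow> x + y \<in> K"
    and mult: "\<And>x y. x \<in> K \<Longrightarrow> y \<in> K \<Longrightarrow> x * y \<in> K"
    and um: "\<And>x. x \<in> K \<Longrightarrow> - x \<in> K" and inv: "\<And>x. x \<in> K \<Longrightarrow> inverse x \<in> K"
    using assms by (auto simp: is_subfield_def)
  show "0 \<in> K" using add[OF one um[OF one]] by simp
  show "x - y \<in> K" if "x \<in> K" "y \<in> K" for x y
    using add[OF that(1) um[OF that(2)]] by simp
  show "x / y \<in> K" if "x \<in> K" "y \<in> K" for x y
    using mult[OF that(1) inv[OF that(2)]] by (simp add: divide_inverse)
qed

lemma subfield_sum: "is_subfield K \<Longrightarrow> (\<And>i. i \<in> A \<Longrightarrow> f i \<in> K) \<Longrightarrow> sum f A \<in> K"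
  by (induction A rule: infinite_finite_induct) (auto intro: subfield_zero subfield_add)

lemma subfield_power: "is_subfield K \<Longrightarrow> x \<in> K \<Longrightarrow> x ^ n \<in> K"
  by (induction n) (auto intro: subfield_one subfield_mult)

text \<open>Bridge between the carrier-based \<open>generate_field\<close> and type class fields.
  The predicate asks for inverses at 0 as well, which is consistent because
  \<open>inverse 0 = 0\<close>. From here on generated fields are handled only through closure,
  inclusion and minimality.\<close>

lemma subfield_field_gen: "is_subfield (field_gen S)"
  and field_gen_incl: "S \<subseteq> field_gen S"
  and field_gen_minimal: "is_subfield K \<Longrightarrow> S \<subseteq> K \<Longrightarrow> field_gen S \<subseteq> K"
proof -
  let ?R = "ring_of_type_algebra :: 'a ring"
  interpret R: field ?R by (rule field_from_type_algebra)
  have [simp]: "carrier ?R = UNIV" "x \<otimes>\<^bsub>?R\<^esub> y = x * y" "x \<oplus>\<^bsub>?R\<^esub> y = x + y" "\<one>\<^bsub>?R\<^esub> = 1" "\<zero>\<^bsub>?R\<^esub> = 0" for x y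
    by (auto simp: ring_of_type_algebra_def)
  have um: "\<ominus>\<^bsub>?R\<^esub> x = - x" for x
    by (rule R.minus_equality) auto
  have inv: "inv\<^bsub>?R\<^esub> x = inverse x" if "x \<noteq> 0" for x
    by (rule R.comm_inv_char) (use that in auto)
  show "is_subfield (field_gen S)"
    unfolding is_subfield_def
  proof (intro conjI ballI)
    show "1 \<in> field_gen S" using generate_field.one[of ?R S] by simp
    show "x + y \<in> field_gen S" if "x \<in> field_gen S" "y \<in> field_gen S" for x y
      using generate_field.eng_add[OF that] by simp
    show "x * y \<in> field_gen S" if "x \<in> field_gen S" "y \<in> field_gen S" for x y
      using generate_field.eng_mult[OF that] by simp
    show "- x \<in> field_gen S" if "x \<in> field_gen S" for x
      using generate_field.a_inv[OF that] by (simp add: um)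
    show "inverse x \<in> field_gen S" if "x \<in> field_gen S" for x
      using generate_field.m_inv[OF that] that by (cases "x = 0") (simp_all add: inv)
  qed
  show "S \<subseteq> field_gen S" by (auto intro: generate_field.incl)
  show "field_gen S \<subseteq> K" if "is_subfield K" "S \<subseteq> K"
  proof
    fix x assume "x \<in> field_gen S"
    then show "x \<in> K"
      by induction (use that in \<open>auto simp: um inv intro: subfield_one subfield_add subfield_mult
          subfield_uminus subfield_inverse\<close>)
  qed
qed

lemma field_gen_mono: "S \<subseteq> field_gen T \<Longrightarrow> field_gen S \<subseteq> field_gen T"
  by (rule field_gen_minimal[OF subfield_field_gen])

section \<open>Univariate polynomials over a subfield and simple algebraic extensions\<close>

definition coeffs_in :: "'b::Fields.field set \<Rightarrow> 'b poly \<Rightarrow> bool" where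
  "coeffs_in K p \<longleftrightarrow> (\<forall>i. poly.coeff p i \<in> K)"

lemma coeffs_in_pCons: "coeffs_in K (pCons c p) \<longleftrightarrow> c \<in> K \<and> coeffs_in K p"
  unfolding coeffs_in_def by (metis coeff_pCons_0 coeff_pCons_Suc not0_implies_Suc)

text \<open>Relative to a set \<open>M\<close> because \<open>act_rat g\<close> is defined by a
  choice of fraction and is controlled only on \<open>rat_funs n\<close>.\<close>

definition field_hom_on :: "'b::Fields.field set \<Rightarrow> ('b \<Rightarrow> 'b) \<Rightarrow> bool" where
  "field_hom_on M \<phi> \<longleftrightarrow> (\<forall>a\<in>M. \<forall>b\<in>M. \<phi> (a + b) = \<phi> a + \<phi> b \<and> \<phi> (a * b) = \<phi> a * \<phi> b)"

context
  fixes K :: "'b::Fields.field set"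
  assumes K: "is_subfield K"
begin

lemma coeffs_in_0: "coeffs_in K 0"
  using K by (simp add: coeffs_in_def subfield_zero)

lemma coeffs_in_const: "c \<in> K \<Longrightarrow> coeffs_in K [:c:]"
  by (simp add: coeffs_in_pCons coeffs_in_0)

lemma coeffs_in_add: "coeffs_in K p \<Longrightarrow> coeffs_in K q \<Longrightarrow> coeffs_in K (p + q)"
  using K by (simp add: coeffs_in_def subfield_add)

lemma coeffs_in_diff: "coeffs_in K p \<Longrightarrow> coeffs_in K q \<Longrightarrow> coeffs_in K (p - q)"
  using K by (simp add: coeffs_in_def subfield_diff)

lemma coeffs_in_uminus: "coeffs_in K p \<Longrightarrow> coeffs_in K (- p)"
  using K by (simp add: coeffs_in_def subfield_uminus)

lemma coeffs_in_smult: "c \<in> K \<Longrightarrow> coeffs_in K p \<Longrightarrow> coeffs_in K (Polynomial.smult c p)"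
  using K by (simp add: coeffs_in_def subfield_mult)

lemma coeffs_in_mult: "coeffs_in K p \<Longrightarrow> coeffs_in K q \<Longrightarrow> coeffs_in K (p * q)"
  unfolding coeffs_in_def coeff_mult by (auto intro!: subfield_sum subfield_mult K)

lemma coeffs_in_prod: "(\<And>i. i \<in> A \<Longrightarrow> coeffs_in K (f i)) \<Longrightarrow> coeffs_in K (prod f A)"
  by (induction A rule: infinite_finite_induct)
    (auto intro: coeffs_in_mult simp: one_pCons coeffs_in_const subfield_one[OF K])

text \<open>Long division uses only field operations on coefficients; the induction follows its
  recursion on \<open>pCons\<close>.\<close>

lemma coeffs_in_div_mod:
  assumes "coeffs_in K q" and "coeffs_in K p"
  shows "coeffs_in K (p div q) \<and> coeffs_in K (p mod q)"
  using assms(2)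
proof (induction p)
  case 0
  then show ?case by (simp add: coeffs_in_0)
next
  case (pCons c p)
  then have IH: "coeffs_in K (p div q)" "coeffs_in K (p mod q)" and c: "c \<in> K"
    by (auto simp: coeffs_in_pCons)
  have r: "coeffs_in K (pCons c (p mod q))"
    using IH(2) c by (simp add: coeffs_in_pCons)
  have b: "poly.coeff (pCons c (p mod q)) (Polynomial.degree q) / poly.coeff q (Polynomial.degree q) \<in> K"
    using r assms(1) unfolding coeffs_in_def by (blast intro: subfield_divide[OF K])
  show ?case
  proof (cases "q = 0")
    case False
    then show ?thesis
      unfolding div_pCons_eq mod_pCons_eq Let_def
      using IH r b assms(1) by (auto simp: coeffs_in_pCons intro!: coeffs_in_diff coeffs_in_smult)
  qed (use pCons.prems in \<open>simp add: coeffs_in_0\<close>)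
qed

text \<open>\<open>K[x]\<close> is closed under inverses when \<open>x\<close> is algebraic over
  \<open>K\<close>. After reduction modulo a polynomial \<open>\<mu>\<close> of least degree
  vanishing at \<open>x\<close>, divide: \<open>\<mu> = s * a + r\<close> gives
  \<open>s(x) a(x) = - r(x)\<close>, and \<open>r\<close> has smaller degree than \<open>a\<close>,
  so its inverse is available by induction.\<close>

lemma coeffs_in_poly_inverse:
  assumes p: "coeffs_in K p" "p \<noteq> 0" "poly p x = 0" and a: "coeffs_in K a" "poly a x \<noteq> 0"
  shows "\<exists>b. coeffs_in K b \<and> poly b x = inverse (poly a x)"
proof -
  \<comment> \<open>Leastness takes the place of irreducibility: a nonzero polynomial over
    \<open>K\<close> of degree below \<open>min\<close> cannot vanish at \<open>x\<close>.\<close>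
  define min where "min = (LEAST n. \<exists>p. coeffs_in K p \<and> p \<noteq> 0 \<and> poly p x = 0 \<and> Polynomial.degree p = n)"
  have "\<exists>n p. coeffs_in K p \<and> p \<noteq> 0 \<and> poly p x = 0 \<and> Polynomial.degree p = n"
    using p by blast
  from LeastI_ex[OF this] obtain \<mu> where \<mu>: "coeffs_in K \<mu>" "\<mu> \<noteq> 0" "poly \<mu> x = 0" "Polynomial.degree \<mu> = min"
    unfolding min_def by blast
  have minimal: "min \<le> Polynomial.degree p" if "coeffs_in K p" "p \<noteq> 0" "poly p x = 0" for p
    unfolding min_def by (rule Least_le) (use that in blast)
  have small: "\<exists>b. coeffs_in K b \<and> poly b x = inverse (poly a x)"
    if "coeffs_in K a" "a \<noteq> 0" "Polynomial.degree a < min" for a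
    using that
  proof (induction "Polynomial.degree a" arbitrary: a rule: less_induct)
    case less
    show ?case
    proof (cases "Polynomial.degree a = 0")
      case True
      then obtain c where c: "a = [:c:]" by (metis degree_eq_zeroE)
      then have "c \<in> K" using less.prems by (simp add: coeffs_in_pCons)
      then have "coeffs_in K [:inverse c:]" by (intro coeffs_in_const subfield_inverse K)
      then show ?thesis by (intro exI[of _ "[:inverse c:]"]) (simp add: c)
    next
      case False
      define r s where "r = \<mu> mod a" and "s = \<mu> div a"
      have rs: "coeffs_in K r" "coeffs_in K s" using coeffs_in_div_mod[OF less.prems(1) \<mu>(1)] by (auto simp: r_def s_def)
      have "\<mu> = s * a + r" by (simp add: r_def s_def)
      then have eq: "poly s x * poly a x = - poly r x"
        using \<mu>(3) by (metis eq_neg_iff_add_eq_0 poly_add poly_mult)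
      \<comment> \<open>A divisor \<open>a\<close> of positive degree would split
        \<open>\<mu>\<close> into two factors of degree below \<open>min\<close>, both nonzero at
        \<open>x\<close>, although their product vanishes there.\<close>
      have "a dvd \<mu> \<Longrightarrow> False"
      proof -
        assume "a dvd \<mu>"
        then have "r = 0" and m: "\<mu> = s * a" by (simp_all add: r_def s_def)
        have "s \<noteq> 0" using m \<mu>(2) by auto
        have "Polynomial.degree \<mu> = Polynomial.degree s + Polynomial.degree a"
          using m \<open>s \<noteq> 0\<close> less.prems(2) by (simp add: degree_mult_eq)
        then have "Polynomial.degree s < min" using False \<mu>(4) by simp
        then have "poly s x \<noteq> 0" using minimal[OF rs(2) \<open>s \<noteq> 0\<close>] by auto
        moreover have "poly a x \<noteq> 0" using minimal[OF less.prems(1,2)] less.prems(3) by auto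
        ultimately show False using eq \<open>r = 0\<close> by simp
      qed
      then have r0: "r \<noteq> 0" by (auto simp: r_def mod_eq_0_iff_dvd)
      have deg: "Polynomial.degree r < Polynomial.degree a"
        using degree_mod_less[of a \<mu>] less.prems(2) r0 by (auto simp: r_def)
      then have "Polynomial.degree r < min" using less.prems(3) by simp
      with less.hyps[OF deg rs(1) r0] obtain b where b: "coeffs_in K b" "poly b x = inverse (poly r x)"
        by blast
      have rx: "poly r x \<noteq> 0" using minimal[OF rs(1) r0] \<open>Polynomial.degree r < min\<close> by auto
      then have ax: "poly a x \<noteq> 0" "poly s x \<noteq> 0" using eq by auto
      have "poly (- (s * b)) x = - poly s x / poly r x"
        by (simp add: b divide_inverse)
      also have "poly r x = - (poly s x * poly a x)" using eq by simp
      finally have "poly (- (s * b)) x = inverse (poly a x)"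
        using ax by (simp add: field_simps)
      then show ?thesis
        using rs b by (intro exI[of _ "- (s * b)"] conjI coeffs_in_uminus coeffs_in_mult)
    qed
  qed
  have eq: "poly a x = poly (a mod \<mu>) x"
    using \<mu>(3) by (metis add_0 div_mult_mod_eq mult_zero_right poly_add poly_mult)
  then have nz: "a mod \<mu> \<noteq> 0" using a by auto
  then have "Polynomial.degree (a mod \<mu>) < min"
    using degree_mod_less[OF \<mu>(2), of a] \<mu>(4) by auto
  then show ?thesis
    unfolding eq using small[OF _ nz] coeffs_in_div_mod[OF \<mu>(1) a(1)] by blast
qed

text \<open>The values at \<open>x\<close> of polynomials over \<open>K\<close> already form a
  field, so they exhaust \<open>K(x)\<close>; reducing modulo \<open>p\<close> bounds the degree.
  Any nonzero \<open>p\<close> vanishing at \<open>x\<close> will do, irreducible or not.\<close>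

lemma field_gen_insert_poly:
  assumes p: "coeffs_in K p" "p \<noteq> 0" "poly p x = 0" and f: "f \<in> field_gen (insert x K)"
  obtains a where "coeffs_in K a" "Polynomial.degree a < Polynomial.degree p" "poly a x = f"
proof -
  let ?A = "{poly a x | a. coeffs_in K a}"
  have "is_subfield ?A"
    unfolding is_subfield_def
  proof (intro conjI ballI)
    have "coeffs_in K 1" unfolding one_pCons by (intro coeffs_in_const subfield_one K)
    then show "1 \<in> ?A" by (force intro: exI[of _ 1])
    fix u assume "u \<in> ?A"
    then obtain a where a: "coeffs_in K a" "u = poly a x" by blast
    show "- u \<in> ?A" using a by (auto intro!: exI[of _ "- a"] coeffs_in_uminus)
    show "inverse u \<in> ?A"
    proof (cases "u = 0")
      case False
      then show ?thesis using coeffs_in_poly_inverse[OF p a(1)] a(2) by force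
    next
      case True
      then show ?thesis using \<open>u \<in> ?A\<close> by simp
    qed
    fix v assume "v \<in> ?A"
    then obtain b where b: "coeffs_in K b" "v = poly b x" by blast
    show "u + v \<in> ?A" using a b by (auto intro!: exI[of _ "a + b"] coeffs_in_add)
    show "u * v \<in> ?A" using a b by (auto intro!: exI[of _ "a * b"] coeffs_in_mult)
  qed
  moreover have "insert x K \<subseteq> ?A"
  proof -
    have "coeffs_in K [:0, 1:]" by (simp add: coeffs_in_pCons coeffs_in_0 subfield_one[OF K] subfield_zero[OF K])
    then have "x \<in> ?A" by (auto intro!: exI[of _ "[:0, 1:]"])
    moreover have "k \<in> ?A" if "k \<in> K" for k
      using coeffs_in_const[OF that] by (auto intro!: exI[of _ "[:k:]"])
    ultimately show ?thesis by blast
  qed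
  ultimately obtain a where a: "coeffs_in K a" "f = poly a x"
    using field_gen_minimal f by blast
  have eq: "poly (a mod p) x = f"
    using p(3) a(2) by (metis add_0 div_mult_mod_eq mult_zero_right poly_add poly_mult)
  have "Polynomial.degree p \<noteq> 0"
  proof
    assume "Polynomial.degree p = 0"
    then obtain c where "p = [:c:]" by (metis degree_eq_zeroE)
    then show False using p by simp
  qed
  then have "Polynomial.degree (a mod p) < Polynomial.degree p"
    using degree_mod_less[OF p(2), of a] by auto
  then show thesis using that eq coeffs_in_div_mod[OF p(1) a(1)] by blast
qed

text \<open>
  An element of \<open>K(x)\<close> is a polynomial in \<open>x\<close> of degree less than \<open>deg p\<close>. If it is fixed, its
  difference to that polynomial vanishes at all conjugates of \<open>x\<close>, so the polynomial is constant.
\<close>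

lemma fixed_in_base_field:
  assumes p: "coeffs_in K p" "p \<noteq> 0" "poly p x = 0" and f: "f \<in> field_gen (insert x K)"
    and M: "is_subfield M" "K \<subseteq> M" "x \<in> M"
    and hom: "\<And>\<phi>. \<phi> \<in> \<Phi> \<Longrightarrow> field_hom_on M \<phi>"
    and fix_K: "\<And>\<phi> k. \<phi> \<in> \<Phi> \<Longrightarrow> k \<in> K \<Longrightarrow> \<phi> k = k"
    and fix_f: "\<And>\<phi>. \<phi> \<in> \<Phi> \<Longrightarrow> \<phi> f = f"
    and card: "Polynomial.degree p \<le> card ((\<lambda>\<phi>. \<phi> x) ` \<Phi>)"
  shows "f \<in> K"
proof -
  obtain a where a: "coeffs_in K a" "Polynomial.degree a < Polynomial.degree p" "poly a x = f"
    using field_gen_insert_poly[OF p f] .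
  \<comment> \<open>Membership in \<open>M\<close> is carried along in the induction, since
    \<open>\<phi>\<close> respects sums and products only of elements of \<open>M\<close>.\<close>
  have phi: "\<phi> (poly b x) = poly b (\<phi> x) \<and> poly b x \<in> M" if \<phi>: "\<phi> \<in> \<Phi>" and "coeffs_in K b" for b \<phi>
    using that(2)
  proof (induction b)
    case 0
    then show ?case using fix_K[OF \<phi>] subfield_zero[OF K] subfield_zero[OF M(1)] by simp
  next
    case (pCons c b)
    then have c: "c \<in> K" "c \<in> M" and IH: "\<phi> (poly b x) = poly b (\<phi> x)" "poly b x \<in> M"
      using M(2) by (auto simp: coeffs_in_pCons)
    have xb: "x * poly b x \<in> M" using M(1,3) IH(2) by (intro subfield_mult)
    have "\<phi> (c + x * poly b x) = c + \<phi> x * poly b (\<phi> x)"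
      using hom[OF \<phi>] xb c IH M(3) fix_K[OF \<phi>] unfolding field_hom_on_def by simp
    then show ?case using xb c by (simp add: subfield_add[OF M(1)])
  qed
  have "a - [:f:] = 0"
  proof (rule ccontr)
    assume nz: "a - [:f:] \<noteq> 0"
    have "(\<lambda>\<phi>. \<phi> x) ` \<Phi> \<subseteq> {y. poly (a - [:f:]) y = 0}"
      using phi[OF _ a(1)] fix_f a(3) by auto
    then have "card ((\<lambda>\<phi>. \<phi> x) ` \<Phi>) \<le> card {y. poly (a - [:f:]) y = 0}"
      by (rule card_mono[OF poly_roots_finite[OF nz]])
    also have "\<dots> \<le> Polynomial.degree (a - [:f:])" by (rule card_poly_roots_bound[OF nz])
    also have "\<dots> < Polynomial.degree p"
      using degree_diff_le[of a "Polynomial.degree a" "[:f:]"] a(2) by simp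
    finally show False using card by simp
  qed
  then show ?thesis using a(1) by (simp add: coeffs_in_pCons)
qed

end

section \<open>Polynomial substitution and the action on rational functions\<close>

lemma const_0 [simp]: "const 0 = 0"
  and const_1 [simp]: "const 1 = (1 :: 'a::comm_ring_1 mpoly)"
  by (simp_all add: const_def)

lemma const_add: "const (a + b) = const a + const b"
  by (simp add: const_def single_add)

lemma const_mult: "const (a * b) = (const a * const b :: 'a::comm_ring_1 mpoly)"
  by (simp add: const_def mult_single)

lemma const_power: "const (a ^ n) = (const a ^ n :: 'a::comm_ring_1 mpoly)"
  by (induction n) (simp_all add: const_mult)

lemma const_uminus: "const (- a) = - (const a :: 'a::comm_ring_1 mpoly)"
  by (simp add: const_def single_uminus)

lemma const_diff: "const (a - b) = (const a - const b :: 'a::comm_ring_1 mpoly)"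
  by (simp add: const_def single_diff)

lemma const_eq_iff [simp]: "const a = const b \<longleftrightarrow> a = b"
  by (metis const_def lookup_single_eq)

lemma const_sum: "const (sum f A) = (\<Sum>i\<in>A. const (f i) :: 'a::comm_ring_1 mpoly)"
  by (induction A rule: infinite_finite_induct) (simp_all add: const_add)

definition monom_subst :: "(nat \<Rightarrow> 'a::comm_ring_1 mpoly) \<Rightarrow> (nat \<Rightarrow>\<^sub>0 nat) \<Rightarrow> 'a mpoly" where
  "monom_subst \<sigma> \<mu> = (\<Prod>i\<in>Poly_Mapping.keys \<mu>. \<sigma> i ^ Poly_Mapping.lookup \<mu> i)"

text \<open>Generalizes \<open>act_poly g\<close>, which is the case
  \<open>\<sigma> = act_var g\<close>. Arbitrary \<open>\<sigma>\<close> also allows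
  \<open>\<sigma> = Var\<close>, the source of the induction principle for
  \<open>polys n\<close>.\<close>

definition poly_subst :: "(nat \<Rightarrow> 'a::comm_ring_1 mpoly) \<Rightarrow> 'a mpoly \<Rightarrow> 'a mpoly" where
  "poly_subst \<sigma> p =
     (\<Sum>\<mu>\<in>Poly_Mapping.keys p. const (Poly_Mapping.lookup p \<mu>) * monom_subst \<sigma> \<mu>)"

lemma monom_subst_superset:
  "finite A \<Longrightarrow> Poly_Mapping.keys \<mu> \<subseteq> A \<Longrightarrow> monom_subst \<sigma> \<mu> = (\<Prod>i\<in>A. \<sigma> i ^ Poly_Mapping.lookup \<mu> i)"
  unfolding monom_subst_def by (rule prod.mono_neutral_left) (auto simp: in_keys_iff)

lemma poly_subst_superset:
  "finite A \<Longrightarrow> Poly_Mapping.keys p \<subseteq> A \<Longrightarrow>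
     poly_subst \<sigma> p = (\<Sum>\<mu>\<in>A. const (Poly_Mapping.lookup p \<mu>) * monom_subst \<sigma> \<mu>)"
  unfolding poly_subst_def by (rule sum.mono_neutral_left) (auto simp: in_keys_iff)

lemma monom_subst_add: "monom_subst \<sigma> (\<mu> + \<nu>) = monom_subst \<sigma> \<mu> * monom_subst \<sigma> \<nu>"
proof -
  let ?A = "Poly_Mapping.keys \<mu> \<union> Poly_Mapping.keys \<nu>"
  have "Poly_Mapping.keys (\<mu> + \<nu>) \<subseteq> ?A" by (rule keys_add)
  then show ?thesis
    by (simp add: monom_subst_superset[of ?A] lookup_add power_add prod.distrib)
qed

lemma poly_subst_add: "poly_subst \<sigma> (p + q) = poly_subst \<sigma> p + poly_subst \<sigma> q"
proof -
  let ?A = "Poly_Mapping.keys p \<union> Poly_Mapping.keys q"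
  have "Poly_Mapping.keys (p + q) \<subseteq> ?A" by (rule keys_add)
  then show ?thesis
    by (simp add: poly_subst_superset[of ?A] lookup_add const_add sum.distrib algebra_simps)
qed

lemma poly_subst_single: "poly_subst \<sigma> (Poly_Mapping.single \<mu> c) = const c * monom_subst \<sigma> \<mu>"
  by (cases "c = 0") (simp_all add: poly_subst_def)

lemma poly_subst_0 [simp]: "poly_subst \<sigma> 0 = 0"
  by (simp add: poly_subst_def)

lemma poly_subst_sum: "poly_subst \<sigma> (sum f A) = (\<Sum>i\<in>A. poly_subst \<sigma> (f i))"
  by (induction A rule: infinite_finite_induct) (simp_all add: poly_subst_add)

lemma poly_mapping_sum_singles:
  "p = (\<Sum>\<mu>\<in>Poly_Mapping.keys p. Poly_Mapping.single \<mu> (Poly_Mapping.lookup p \<mu>))"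
  by (rule poly_mapping_eqI) (auto simp: lookup_sum lookup_single when_def in_keys_iff)

lemma poly_subst_mult: "poly_subst \<sigma> (p * q) = poly_subst \<sigma> p * poly_subst \<sigma> q"
proof -
  let ?s = "\<lambda>p \<mu>. Poly_Mapping.single \<mu> (Poly_Mapping.lookup p \<mu>) :: 'a mpoly"
  have "p * q = (\<Sum>\<mu>\<in>Poly_Mapping.keys p. \<Sum>\<nu>\<in>Poly_Mapping.keys q. ?s p \<mu> * ?s q \<nu>)"
    by (subst (1) poly_mapping_sum_singles[of p], subst (1) poly_mapping_sum_singles[of q])
      (simp add: sum_product)
  then have "poly_subst \<sigma> (p * q) =
      (\<Sum>\<mu>\<in>Poly_Mapping.keys p. \<Sum>\<nu>\<in>Poly_Mapping.keys q.
         (const (Poly_Mapping.lookup p \<mu>) * monom_subst \<sigma> \<mu>) *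
         (const (Poly_Mapping.lookup q \<nu>) * monom_subst \<sigma> \<nu>))"
    by (simp add: poly_subst_sum mult_single poly_subst_single monom_subst_add const_mult mult_ac)
  also have "\<dots> = poly_subst \<sigma> p * poly_subst \<sigma> q"
    by (simp add: poly_subst_def sum_product)
  finally show ?thesis .
qed

lemma poly_subst_const [simp]: "poly_subst \<sigma> (const c) = const c"
  unfolding const_def[of c] poly_subst_single by (simp add: monom_subst_def const_def)

lemma poly_subst_1 [simp]: "poly_subst \<sigma> 1 = 1"
  using poly_subst_const[of \<sigma> 1] by simp

lemma poly_subst_Var [simp]: "poly_subst \<sigma> (Var i) = \<sigma> i"
  unfolding Var_def poly_subst_single by (simp add: monom_subst_def)

lemma poly_subst_power: "poly_subst \<sigma> (p ^ n) = poly_subst \<sigma> p ^ n"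
  by (induction n) (simp_all add: poly_subst_mult)

lemma poly_subst_prod: "poly_subst \<sigma> (prod f A) = (\<Prod>i\<in>A. poly_subst \<sigma> (f i))"
  by (induction A rule: infinite_finite_induct) (simp_all add: poly_subst_mult)

lemma monom_subst_Var: "monom_subst Var \<mu> = Poly_Mapping.single \<mu> (1 :: 'a::comm_ring_1)"
proof -
  have pow: "(Var i :: 'a mpoly) ^ k = Poly_Mapping.single (Poly_Mapping.single i k) 1" for i k
    by (induction k) (simp_all add: Var_def mult_single single_add[symmetric])
  have "(\<Prod>i\<in>A. Poly_Mapping.single (f i) (1 :: 'a)) = Poly_Mapping.single (sum f A) 1"
    if "finite A" for A and f :: "nat \<Rightarrow> (nat \<Rightarrow>\<^sub>0 nat)"
    using that by (induction A) (simp_all add: mult_single)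
  then show ?thesis
    unfolding monom_subst_def pow
    by (simp add: poly_mapping_sum_singles[symmetric])
qed

lemma poly_subst_Var_id: "poly_subst Var p = p"
proof -
  have "poly_subst Var p = (\<Sum>\<mu>\<in>Poly_Mapping.keys p. Poly_Mapping.single \<mu> (Poly_Mapping.lookup p \<mu>))"
    by (simp add: poly_subst_def monom_subst_Var const_def mult_single)
  then show ?thesis using poly_mapping_sum_singles[of p] by simp
qed

section \<open>The polynomial ring in the first n variables\<close>

lemma const_in_polys [simp]: "const c \<in> polys n"
  by (auto simp: polys_def const_def)

lemma polys_0 [simp]: "0 \<in> polys n" and polys_1 [simp]: "(1 :: 'a::comm_ring_1 mpoly) \<in> polys n"
  by (auto simp: polys_def)

lemma Var_in_polys: "i \<in> {1..n} \<Longrightarrow> Var i \<in> polys n"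
  by (auto simp: polys_def Var_def)

lemma polys_add: "p \<in> polys n \<Longrightarrow> q \<in> polys n \<Longrightarrow> p + q \<in> polys n"
  using keys_add[of p q] unfolding polys_def by blast

lemma polys_uminus: "p \<in> polys n \<Longrightarrow> - p \<in> polys n" for p :: "'a::comm_ring_1 mpoly"
  by (simp add: polys_def in_keys_iff)

lemma polys_diff: "p \<in> polys n \<Longrightarrow> q \<in> polys n \<Longrightarrow> p - q \<in> polys n" for p :: "'a::comm_ring_1 mpoly"
  using polys_add[OF _ polys_uminus, of p n q] by simp

lemma polys_mult:
  fixes p q :: "'a::comm_ring_1 mpoly"
  assumes "p \<in> polys n" "q \<in> polys n"
  shows "p * q \<in> polys n"
proof -
  have "Poly_Mapping.keys \<rho> \<subseteq> {1..n}" if \<rho>: "\<rho> \<in> Poly_Mapping.keys (p * q)" for \<rho>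
  proof -
    obtain \<mu> \<nu> where "\<mu> \<in> Poly_Mapping.keys p" "\<nu> \<in> Poly_Mapping.keys q" "\<rho> = \<mu> + \<nu>"
      using keys_mult[of p q] \<rho> by blast
    then show ?thesis using assms keys_add[of \<mu> \<nu>] unfolding polys_def by blast
  qed
  then show ?thesis by (auto simp: polys_def)
qed

lemma polys_sum: "(\<And>i. i \<in> A \<Longrightarrow> f i \<in> polys n) \<Longrightarrow> sum f A \<in> polys n"
  by (induction A rule: infinite_finite_induct) (auto intro: polys_add)

lemma polys_prod: "(\<And>i. i \<in> A \<Longrightarrow> f i \<in> polys n) \<Longrightarrow> prod f A \<in> polys n"
  for f :: "'b \<Rightarrow> 'a::comm_ring_1 mpoly"
  by (induction A rule: infinite_finite_induct) (auto intro: polys_mult)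

lemma polys_power: "p \<in> polys n \<Longrightarrow> p ^ k \<in> polys n" for p :: "'a::comm_ring_1 mpoly"
  by (induction k) (auto intro: polys_mult)

lemma polys_mono: "k \<le> n \<Longrightarrow> polys k \<subseteq> polys n"
  by (force simp: polys_def)

text \<open>Substituting the variables for themselves writes \<open>p\<close> as a sum of constants
  times products of variables, all with index in \<open>{1..n}\<close>.\<close>

lemma polys_induct [consumes 1, case_names const Var add mult]:
  fixes p :: "'a::comm_ring_1 mpoly"
  assumes p: "p \<in> polys n"
    and c: "\<And>c. P (const c)" and v: "\<And>i. i \<in> {1..n} \<Longrightarrow> P (Var i)"
    and a: "\<And>p q. P p \<Longrightarrow> P q \<Longrightarrow> P (p + q)"
    and m: "\<And>p q. P p \<Longrightarrow> P q \<Longrightarrow> P (p * q)"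
  shows "P p"
proof -
  have one: "P 1" and zero: "P 0" using c[of 1] c[of 0] by simp_all
  have pow: "P (Var i ^ k)" if "i \<in> {1..n}" for i k
    by (induction k) (use one v[OF that] m in auto)
  have prod: "P (prod f A)" if "\<And>i. i \<in> A \<Longrightarrow> P (f i)" for f and A :: "nat set"
    using that by (induction A rule: infinite_finite_induct) (auto intro: one m)
  have sum: "P (sum f A)" if "\<And>i. i \<in> A \<Longrightarrow> P (f i)" for f and A :: "(nat \<Rightarrow>\<^sub>0 nat) set"
    using that by (induction A rule: infinite_finite_induct) (auto intro: zero a)
  have "P (poly_subst Var p)"
    unfolding poly_subst_def monom_subst_def
  proof (intro sum m c prod pow)
    fix \<mu> i assume "\<mu> \<in> Poly_Mapping.keys p" "i \<in> Poly_Mapping.keys \<mu>"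
    then show "i \<in> {1..n}" using p unfolding polys_def by blast
  qed
  then show ?thesis by (simp add: poly_subst_Var_id)
qed

section \<open>The general linear group and its action on polynomials\<close>

lemma carrier_GL: "g \<in> carrier (GL n) \<longleftrightarrow>
    g \<in> carrier_mat n n \<and> (\<exists>h\<in>carrier_mat n n. h * g = 1\<^sub>m n \<and> g * h = 1\<^sub>m n)"
  by (auto simp: GL_def units_of_carrier Units_def ring_mat_simps)

lemma GL_mult [simp]: "g \<otimes>\<^bsub>GL n\<^esub> h = g * h"
  and GL_one [simp]: "\<one>\<^bsub>GL n\<^esub> = 1\<^sub>m n"
  by (simp_all add: GL_def units_of_mult units_of_one ring_mat_simps)

lemma group_GL: "Group.group (GL n :: 'a::field mat monoid)"
  unfolding GL_def
  using ring.is_monoid[OF ring_mat] by (rule monoid.units_group)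

lemma GL_carrier_mat: "g \<in> carrier (GL n) \<Longrightarrow> g \<in> carrier_mat n n"
  by (simp add: carrier_GL)

lemma GL_dim [simp]: "g \<in> carrier (GL n) \<Longrightarrow> dim_row g = n" "g \<in> carrier (GL n) \<Longrightarrow> dim_col g = n"
  by (auto simp: carrier_GL)

lemma GL_inverse:
  fixes g :: "'a::field mat"
  assumes "g \<in> carrier (GL n)"
  shows "inv\<^bsub>GL n\<^esub> g \<in> carrier (GL n)" "inv\<^bsub>GL n\<^esub> g * g = 1\<^sub>m n" "g * inv\<^bsub>GL n\<^esub> g = 1\<^sub>m n"
  using group.inv_closed[OF group_GL assms] group.l_inv[OF group_GL assms]
    group.r_inv[OF group_GL assms] by simp_all

lemma GL_inverse_unique:
  fixes g :: "'a::field mat"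
  assumes g: "g \<in> carrier (GL n)" and h: "h \<in> carrier_mat n n" "h * g = 1\<^sub>m n"
  shows "inv\<^bsub>GL n\<^esub> g = h"
proof -
  have "h = h * (g * inv\<^bsub>GL n\<^esub> g)"
    using h GL_inverse[OF g] by simp
  also have "\<dots> = (h * g) * inv\<^bsub>GL n\<^esub> g"
    using h(1) GL_carrier_mat[OF g] GL_carrier_mat[OF GL_inverse(1)[OF g]]
    by (intro assoc_mult_mat[symmetric]) auto
  also have "\<dots> = inv\<^bsub>GL n\<^esub> g"
    using h(2) GL_carrier_mat[OF GL_inverse(1)[OF g]] by simp
  finally show ?thesis by simp
qed

lemma act_poly_subst: "act_poly g = poly_subst (act_var g)"
  by (simp add: fun_eq_iff act_poly_def poly_subst_def monom_subst_def)

lemmas act_poly_simps =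
  poly_subst_add[of "act_var _", folded act_poly_subst]
  poly_subst_mult[of "act_var _", folded act_poly_subst]
  poly_subst_const[of "act_var _", folded act_poly_subst]
  poly_subst_Var[of "act_var _", folded act_poly_subst]
  poly_subst_0[of "act_var _", folded act_poly_subst]
  poly_subst_1[of "act_var _", folded act_poly_subst]
  poly_subst_power[of "act_var _", folded act_poly_subst]

lemmas act_poly_sum = poly_subst_sum[of "act_var _", folded act_poly_subst]
lemmas act_poly_prod = poly_subst_prod[of "act_var _", folded act_poly_subst]

lemma act_var_Suc:
  "g \<in> carrier (GL n) \<Longrightarrow>
     act_var g (Suc i) = (\<Sum>j<n. const ((inv\<^bsub>GL n\<^esub> g) $$ (i, j)) * Var (Suc j))"
  using sum.atLeast1_atMost_eq[of "\<lambda>j. const ((inv\<^bsub>GL n\<^esub> g) $$ (i, j - 1)) * Var j" n]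
  by (simp add: act_var_def)

lemma act_var_in_polys: "g \<in> carrier (GL n) \<Longrightarrow> act_var g i \<in> polys n"
  unfolding act_var_def by (auto intro!: polys_sum polys_mult Var_in_polys)

text \<open>A left action: inversion reverses the order of the matrix product, and composing
  substitutions of variables reverses it once more.\<close>

lemma act_poly_mult_mat:
  assumes g: "g \<in> carrier (GL n)" and h: "h \<in> carrier (GL n)" and p: "p \<in> polys n"
  shows "act_poly (g * h) p = act_poly g (act_poly h p)"
  using p
proof (induction rule: polys_induct)
  case (Var i)
  then obtain k where k: "i = Suc k" "k < n" by (cases i) auto
  have gh: "g * h \<in> carrier (GL n)"
    using group.subgroup_self[OF group_GL] g h subgroup.m_closed by fastforce
  have inv: "inv\<^bsub>GL n\<^esub> (g * h) = inv\<^bsub>GL n\<^esub> h * inv\<^bsub>GL n\<^esub> g"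
    using group.inv_mult_group[OF group_GL g h] by simp
  have dims: "inv\<^bsub>GL n\<^esub> h \<in> carrier_mat n n" "inv\<^bsub>GL n\<^esub> g \<in> carrier_mat n n"
    using GL_inverse(1) g h GL_carrier_mat by blast+
  have entry: "(inv\<^bsub>GL n\<^esub> (g * h)) $$ (k, j) =
      (\<Sum>l<n. (inv\<^bsub>GL n\<^esub> h) $$ (k, l) * (inv\<^bsub>GL n\<^esub> g) $$ (l, j))" if "j < n" for j
    unfolding inv using dims that k by (simp add: scalar_prod_def lessThan_atLeast0)
  have "act_poly (g * h) (Var i) = (\<Sum>j<n. \<Sum>l<n.
      const ((inv\<^bsub>GL n\<^esub> h) $$ (k, l)) * (const ((inv\<^bsub>GL n\<^esub> g) $$ (l, j)) * Var (Suc j)))"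
    by (simp add: act_poly_simps k act_var_Suc[OF gh] entry const_sum const_mult sum_distrib_right mult.assoc)
  also have "\<dots> = act_poly g (act_poly h (Var i))"
    by (subst sum.swap)
      (simp add: act_poly_simps act_poly_sum k act_var_Suc[OF h] act_var_Suc[OF g] sum_distrib_left)
  finally show ?case .
qed (simp_all add: act_poly_simps)

lemma act_poly_one_mat:
  assumes "p \<in> polys n"
  shows "act_poly (1\<^sub>m n) p = p"
  using assms
proof (induction rule: polys_induct)
  case (Var i)
  then obtain k where k: "i = Suc k" "k < n" by (cases i) auto
  have one: "1\<^sub>m n \<in> carrier (GL n)" by (auto simp: carrier_GL)
  have inv: "inv\<^bsub>GL n\<^esub> (1\<^sub>m n) = (1\<^sub>m n :: 'a mat)"
    by (rule GL_inverse_unique[OF one]) simp_all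
  have "act_poly (1\<^sub>m n) (Var i) = (\<Sum>j<n. if j = k then Var (Suc j) else (0 :: 'a mpoly))"
    unfolding act_poly_simps k act_var_Suc[OF one] inv using k by (intro sum.cong) auto
  then show ?case using k by simp
qed (simp_all add: act_poly_simps)

lemma act_poly_inverse:
  assumes "g \<in> carrier (GL n)" "p \<in> polys n"
  shows "act_poly (inv\<^bsub>GL n\<^esub> g) (act_poly g p) = p"
  using act_poly_mult_mat[OF GL_inverse(1)[OF assms(1)] assms] GL_inverse(2)[OF assms(1)]
    act_poly_one_mat[OF assms(2)] by simp

lemma act_poly_inj_on: "g \<in> carrier (GL n) \<Longrightarrow> inj_on (act_poly g) (polys n)"
  by (rule inj_on_inverseI) (rule act_poly_inverse)

lemma act_poly_eq_0_iff:
  "g \<in> carrier (GL n) \<Longrightarrow> p \<in> polys n \<Longrightarrow> act_poly g p = 0 \<longleftrightarrow> p = 0"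
  using inj_onD[OF act_poly_inj_on, of g n p 0] by (auto simp: act_poly_simps)

section \<open>Rational functions and the induced action\<close>

lemma to_rat_add: "to_rat (p + q) = to_rat p + to_rat q"
  and to_rat_mult: "to_rat (p * q) = to_rat p * to_rat q"
  and to_rat_0 [simp]: "to_rat 0 = 0"
  and to_rat_1 [simp]: "to_rat 1 = 1"
  and to_rat_eq_iff [simp]: "to_rat p = to_rat q \<longleftrightarrow> p = q"
  and Fract_eq_divide: "b \<noteq> 0 \<Longrightarrow> Fract a b = to_rat a / to_rat b"
  by (simp_all add: to_rat_def Zero_fract_def One_fract_def eq_fract)

lemma to_rat_eq_0_iff [simp]: "to_rat p = 0 \<longleftrightarrow> p = 0"
  using to_rat_eq_iff[of p 0] by simp

lemma to_rat_sum: "to_rat (sum f A) = (\<Sum>i\<in>A. to_rat (f i))"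
  by (induction A rule: infinite_finite_induct) (simp_all add: to_rat_add)

lemma to_rat_prod: "to_rat (prod f A) = (\<Prod>i\<in>A. to_rat (f i))"
  by (induction A rule: infinite_finite_induct) (simp_all add: to_rat_mult)

lemma to_rat_power: "to_rat (p ^ k) = to_rat p ^ k"
  by (induction k) (simp_all add: to_rat_mult)

lemma rat_funs_iff:
  "f \<in> rat_funs n \<longleftrightarrow> (\<exists>a b. a \<in> polys n \<and> b \<in> polys n \<and> b \<noteq> 0 \<and> f = to_rat a / to_rat b)"
  unfolding rat_funs_def mem_Collect_eq by (metis Fract_eq_divide)

lemma to_rat_in_rat_funs: "p \<in> polys n \<Longrightarrow> to_rat p \<in> rat_funs n"
  unfolding rat_funs_iff by (intro exI[of _ p] exI[of _ 1]) auto

lemma subfield_rat_funs: "is_subfield (rat_funs n :: 'a::field mpoly fract set)"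
  unfolding is_subfield_def
proof (intro conjI ballI)
  show "1 \<in> (rat_funs n :: 'a mpoly fract set)" using to_rat_in_rat_funs[of 1 n] by simp
  fix f :: "'a mpoly fract" assume "f \<in> rat_funs n"
  then obtain a b where f: "a \<in> polys n" "b \<in> polys n" "b \<noteq> 0" "f = to_rat a / to_rat b"
    unfolding rat_funs_iff by blast
  have "- to_rat a = to_rat (- a)" by (rule minus_unique) (simp flip: to_rat_add)
  then show "- f \<in> rat_funs n" unfolding rat_funs_iff using f polys_uminus[OF f(1)]
    by (intro exI[of _ "- a"] exI[of _ b]) (simp flip: \<open>- to_rat a = to_rat (- a)\<close>)
  show "inverse f \<in> rat_funs n"
  proof (cases "a = 0")
    case True
    then show ?thesis using f to_rat_in_rat_funs[OF polys_0] by simp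
  next
    case False
    then show ?thesis unfolding rat_funs_iff using f by (intro exI[of _ b] exI[of _ a]) simp
  qed
  fix g :: "'a mpoly fract" assume "g \<in> rat_funs n"
  then obtain c d where g: "c \<in> polys n" "d \<in> polys n" "d \<noteq> 0" "g = to_rat c / to_rat d"
    unfolding rat_funs_iff by blast
  show "f + g \<in> rat_funs n" unfolding rat_funs_iff using f g
    by (intro exI[of _ "a * d + c * b"] exI[of _ "b * d"])
      (auto simp: to_rat_add to_rat_mult add_frac_eq intro!: polys_add polys_mult)
  show "f * g \<in> rat_funs n" unfolding rat_funs_iff using f g
    by (intro exI[of _ "a * c"] exI[of _ "b * d"]) (auto simp: to_rat_mult intro!: polys_mult)
qed

text \<open>Independence of the chosen fraction: the chosen pair represents the same element, so
  cross multiplication gives a polynomial identity, which \<open>act_poly g\<close> preserves.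
  Denominators stay nonzero because \<open>act_poly g\<close> is injective on
  \<open>polys n\<close>.\<close>

lemma act_rat_divide:
  assumes g: "g \<in> carrier (GL n)" and a: "a \<in> polys n" and b: "b \<in> polys n" "b \<noteq> 0"
  shows "act_rat g (to_rat a / to_rat b) = to_rat (act_poly g a) / to_rat (act_poly g b)"
proof -
  let ?P = "\<lambda>(c, d). c \<in> polys (dim_row g) \<and> d \<in> polys (dim_row g) \<and> d \<noteq> 0 \<and>
              to_rat a / to_rat b = Fract c d"
  obtain c d where cd: "(SOME x. ?P x) = (c, d)" by fastforce
  have "?P (a, b)" using assms by (simp add: Fract_eq_divide)
  then have "?P (c, d)" unfolding cd[symmetric] by (rule someI)
  then have c: "c \<in> polys n" "d \<in> polys n" "d \<noteq> 0" and "to_rat a / to_rat b = to_rat c / to_rat d"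
    using g by (auto simp: Fract_eq_divide)
  then have "to_rat (a * d) = to_rat (c * b)"
    using b by (simp add: to_rat_mult frac_eq_eq)
  then have "act_poly g a * act_poly g d = act_poly g c * act_poly g b"
    by (simp flip: act_poly_simps)
  moreover have nz: "act_poly g d \<noteq> 0" "act_poly g b \<noteq> 0"
    using c b act_poly_eq_0_iff[OF g] by auto
  ultimately have "to_rat (act_poly g c) / to_rat (act_poly g d) =
      to_rat (act_poly g a) / to_rat (act_poly g b)"
    by (simp add: frac_eq_eq flip: to_rat_mult)
  then show ?thesis
    using nz cd by (simp add: act_rat_def Fract_eq_divide)
qed

lemma act_rat_to_rat:
  "g \<in> carrier (GL n) \<Longrightarrow> p \<in> polys n \<Longrightarrow> act_rat g (to_rat p) = to_rat (act_poly g p)"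
  using act_rat_divide[of g n p 1] by (simp add: act_poly_simps)

lemma
  assumes g: "g \<in> carrier (GL n)"
  shows act_rat_hom: "field_hom_on (rat_funs n) (act_rat g)"
    and act_rat_inverse: "f \<in> rat_funs n \<Longrightarrow> act_rat g (inverse f) = inverse (act_rat g f)"
proof -
  show "field_hom_on (rat_funs n) (act_rat g)"
    unfolding field_hom_on_def
  proof (intro ballI)
    fix x y :: "'a mpoly fract" assume "x \<in> rat_funs n" "y \<in> rat_funs n"
    then obtain a b c d where f: "a \<in> polys n" "b \<in> polys n" "b \<noteq> 0" "x = to_rat a / to_rat b"
      "c \<in> polys n" "d \<in> polys n" "d \<noteq> 0" "y = to_rat c / to_rat d"
      unfolding rat_funs_iff by blast
    have nz: "act_poly g b \<noteq> 0" "act_poly g d \<noteq> 0" using f act_poly_eq_0_iff[OF g] by auto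
    have "x + y = to_rat (a * d + c * b) / to_rat (b * d)" "x * y = to_rat (a * c) / to_rat (b * d)"
      using f by (simp_all add: to_rat_add to_rat_mult add_frac_eq)
    moreover have "act_rat g (to_rat (a * d + c * b) / to_rat (b * d)) =
        to_rat (act_poly g (a * d + c * b)) / to_rat (act_poly g (b * d))"
      "act_rat g (to_rat (a * c) / to_rat (b * d)) =
        to_rat (act_poly g (a * c)) / to_rat (act_poly g (b * d))"
      using f by (intro act_rat_divide[OF g]; auto intro: polys_add polys_mult)+
    ultimately show "act_rat g (x + y) = act_rat g x + act_rat g y \<and>
        act_rat g (x * y) = act_rat g x * act_rat g y"
      using f nz by (simp add: act_rat_divide[OF g] act_poly_simps to_rat_add to_rat_mult add_frac_eq)
  qed
  show "act_rat g (inverse f) = inverse (act_rat g f)" if f_in: "f \<in> rat_funs n"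
  proof -
    obtain a b where f: "a \<in> polys n" "b \<in> polys n" "b \<noteq> 0" "f = to_rat a / to_rat b"
      using f_in unfolding rat_funs_iff by blast
    show ?thesis
    proof (cases "a = 0")
      case True
      then show ?thesis using f act_rat_to_rat[OF g polys_0] by (simp add: act_poly_simps)
    next
      case False
      then show ?thesis using f by (simp add: act_rat_divide[OF g])
    qed
  qed
qed

lemma subfield_fixed:
  fixes H :: "'a::field mat set"
  assumes H: "H \<subseteq> carrier (GL n)"
  shows "is_subfield (invariant_field n H)"
proof -
  note R = subfield_rat_funs[of n, where 'a='a]
  have one: "act_rat g 1 = 1" if "g \<in> H" for g
    using act_rat_to_rat[of g n 1] that H by (auto simp: act_poly_simps)
  have neg: "act_rat g (- f) = - f" if "g \<in> H" "f \<in> rat_funs n" "act_rat g f = f" for g f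
  proof -
    have "act_rat g (f + - f) = act_rat g f + act_rat g (- f)"
      using act_rat_hom[of g n] that H subfield_uminus[OF R that(2)] unfolding field_hom_on_def by blast
    moreover have "act_rat g 0 = 0"
      using act_rat_to_rat[of g n 0] that H by (auto simp: act_poly_simps)
    ultimately show ?thesis using that(3) by (simp add: eq_neg_iff_add_eq_0 add.commute)
  qed
  have hom: "act_rat g (f + f') = act_rat g f + act_rat g f'" "act_rat g (f * f') = act_rat g f * act_rat g f'"
    if "g \<in> H" "f \<in> rat_funs n" "f' \<in> rat_funs n" for g f f'
    using act_rat_hom[of g n] that H unfolding field_hom_on_def by blast+
  have inv: "act_rat g (inverse f) = inverse (act_rat g f)" if "g \<in> H" "f \<in> rat_funs n" for g f
    using act_rat_inverse that H by blast
  show ?thesis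
    unfolding is_subfield_def invariant_field_def
    by (simp add: one neg hom inv subfield_one[OF R] subfield_add[OF R] subfield_mult[OF R]
        subfield_uminus[OF R] subfield_inverse[OF R])
qed

section \<open>Additive polynomials in characteristic 2\<close>

text \<open>The zero diagonal is a separate assumption because in characteristic 2 the equation
  \<open>D a a + D a a = 0\<close> says nothing about \<open>D a a\<close>.\<close>

lemma alternating_sum_eq_0:
  fixes D :: "nat \<Rightarrow> nat \<Rightarrow> 'b::comm_ring_1"
  assumes "\<And>a. a < n \<Longrightarrow> D a a = 0" and "\<And>a b. a < n \<Longrightarrow> b < n \<Longrightarrow> D a b + D b a = 0"
  shows "(\<Sum>a<n. \<Sum>b<n. D a b * (x a * x b)) = 0"
  using assms
proof (induction n)
  case (Suc n)
  have "(\<Sum>a<n. D a n * (x a * x n)) + (\<Sum>b<n. D n b * (x n * x b)) =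
      (\<Sum>a<n. (D a n + D n a) * (x a * x n))"
    by (simp add: sum.distrib algebra_simps)
  also have "\<dots> = 0" using Suc.prems(2) by (intro sum.neutral) auto
  finally have cross: "(\<Sum>a<n. D a n * (x a * x n)) + (\<Sum>b<n. D n b * (x n * x b)) = 0" .
  have "(\<Sum>a<Suc n. \<Sum>b<Suc n. D a b * (x a * x b)) =
     (\<Sum>a<n. \<Sum>b<n. D a b * (x a * x b)) +
     ((\<Sum>a<n. D a n * (x a * x n)) + (\<Sum>b<n. D n b * (x n * x b))) + D n n * (x n * x n)"
    by (simp add: sum.distrib algebra_simps)
  then show ?case using Suc cross by simp
qed simp

text \<open>Groups the coordinates into the hyperbolic pairs of the quadratic form.\<close>

lemma sum_reflect: "(\<Sum>k<2 * m. f k) = (\<Sum>k<m. f k + f (2 * m - 1 - k))" for f :: "nat \<Rightarrow> 'b::comm_monoid_add"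
proof -
  have "{..<2 * m} = {..<m} \<union> (\<lambda>k. 2 * m - 1 - k) ` {..<m}"
  proof (intro Set.set_eqI iffI)
    fix k assume "k \<in> {..<2 * m}"
    then show "k \<in> {..<m} \<union> (\<lambda>k. 2 * m - 1 - k) ` {..<m}"
      by (cases "k < m") (auto simp: image_iff intro!: bexI[of _ "2 * m - 1 - k"])
  qed auto
  moreover have "inj_on (\<lambda>k. 2 * m - 1 - k) {..<m}" by (auto simp: inj_on_def)
  moreover have "{..<m} \<inter> (\<lambda>k. 2 * m - 1 - k) ` {..<m} = {}" by auto
  ultimately show ?thesis by (simp add: sum.union_disjoint sum.reindex sum.distrib)
qed

section \<open>The spaces \<open>W_s\<close> of linear forms and the products \<open>P_s\<close>
  over their translates\<close>

primrec var_span :: "nat \<Rightarrow> 'a::comm_ring_1 mpoly set" where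
  "var_span 0 = {0}"
| "var_span (Suc s) = (\<lambda>(c, v). v + const c * Var (Suc s)) ` (UNIV \<times> var_span s)"

lemma finite_var_span: "finite (var_span s :: 'a::{finite,comm_ring_1} mpoly set)"
  by (induction s) auto

text \<open>The recursive form serves finiteness and the splitting of products into cosets; linear
  operations use this explicit form.\<close>

lemma var_span_iff:
  "v \<in> var_span s \<longleftrightarrow> (\<exists>c. v = (\<Sum>l<s. const (c l) * Var (Suc l)))"
proof (induction s arbitrary: v)
  case (Suc s)
  show ?case
  proof
    assume "v \<in> var_span (Suc s)"
    then obtain d c where "v = (\<Sum>l<s. const (c l) * Var (Suc l)) + const d * Var (Suc s)"
      by (auto simp: Suc.IH)
    then have "v = (\<Sum>l<Suc s. const ((c(s := d)) l) * Var (Suc l))" by simp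
    then show "\<exists>c. v = (\<Sum>l<Suc s. const (c l) * Var (Suc l))" by blast
  next
    assume "\<exists>c. v = (\<Sum>l<Suc s. const (c l) * Var (Suc l))"
    then obtain c where "v = (\<Sum>l<s. const (c l) * Var (Suc l)) + const (c s) * Var (Suc s)" by auto
    moreover have "(\<Sum>l<s. const (c l) * Var (Suc l)) \<in> var_span s" using Suc.IH by blast
    ultimately show "v \<in> var_span (Suc s)" by force
  qed
qed simp

lemma var_span_0: "0 \<in> var_span s"
  by (induction s) (force intro: image_eqI[of _ _ "(0, 0)"])+

lemma var_span_add: "u \<in> var_span s \<Longrightarrow> v \<in> var_span s \<Longrightarrow> u + v \<in> var_span s"
  unfolding var_span_iff
proof (elim exE)
  fix c d assume "u = (\<Sum>l<s. const (c l) * Var (Suc l))" "v = (\<Sum>l<s. const (d l) * Var (Suc l))"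
  then have "u + v = (\<Sum>l<s. const (c l + d l) * Var (Suc l))"
    by (simp add: const_add sum.distrib algebra_simps)
  then show "\<exists>c. u + v = (\<Sum>l<s. const (c l) * Var (Suc l))"
    by (intro exI[of _ "\<lambda>l. c l + d l"])
qed

lemma var_span_scale: "v \<in> var_span s \<Longrightarrow> const a * v \<in> var_span s"
  unfolding var_span_iff
proof (elim exE)
  fix c assume "v = (\<Sum>l<s. const (c l) * Var (Suc l))"
  then have "const a * v = (\<Sum>l<s. const (a * c l) * Var (Suc l))"
    by (simp add: const_mult sum_distrib_left algebra_simps)
  then show "\<exists>c. const a * v = (\<Sum>l<s. const (c l) * Var (Suc l))"
    by (intro exI[of _ "\<lambda>l. a * c l"])
qed

lemma var_span_uminus: "v \<in> var_span s \<Longrightarrow> - v \<in> var_span s"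
  using var_span_scale[of v s "- 1"] by (simp add: const_uminus)

lemma var_span_diff: "u \<in> var_span s \<Longrightarrow> v \<in> var_span s \<Longrightarrow> u - v \<in> var_span s"
  using var_span_add[OF _ var_span_uminus, of u s v] by simp

lemma var_span_sum: "(\<And>i. i \<in> A \<Longrightarrow> f i \<in> var_span s) \<Longrightarrow> sum f A \<in> var_span s"
  by (induction A rule: infinite_finite_induct) (auto intro: var_span_0 var_span_add)

lemma Var_in_var_span: "l < s \<Longrightarrow> Var (Suc l) \<in> var_span s"
  by (auto simp: var_span_iff if_distrib[of const] if_distrib[of "\<lambda>x. x * _"] cong: if_cong
      intro!: exI[of _ "\<lambda>j. if j = l then 1 else 0"])

lemma var_span_polys: "var_span s \<subseteq> polys s"
  by (auto simp: var_span_iff intro!: polys_sum polys_mult Var_in_polys)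

lemma Var_notin_polys: "s \<le> l \<Longrightarrow> (Var (Suc l) :: 'a::comm_ring_1 mpoly) \<notin> polys s"
  by (auto simp: polys_def Var_def)

lemma Var_notin_var_span: "s \<le> l \<Longrightarrow> (Var (Suc l) :: 'a::comm_ring_1 mpoly) \<notin> var_span s"
  using Var_notin_polys var_span_polys by blast

lemma add_var_span_cong:
  assumes "w \<in> var_span s"
  shows "bij_betw (\<lambda>v. w + v) (var_span s) (var_span s)"
proof (rule bij_betw_byWitness[where f' = "\<lambda>v. - w + v"])
  show "(\<lambda>v. w + v) ` var_span s \<subseteq> var_span s" using assms by (auto intro: var_span_add)
  show "(\<lambda>v. - w + v) ` var_span s \<subseteq> var_span s"
    using assms by (auto intro: var_span_diff)
qed auto

definition span_prod :: "nat \<Rightarrow> 'a::comm_ring_1 mpoly \<Rightarrow> 'a mpoly" where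
  "span_prod s t = (\<Prod>v\<in>var_span s. t + v)"

lemma span_prod_shift: "w \<in> var_span s \<Longrightarrow> span_prod s (t + w) = span_prod s t"
  unfolding span_prod_def
  using prod.reindex_bij_betw[OF add_var_span_cong, of w s "\<lambda>v. t + v"] by (simp add: add.assoc)

lemma span_prod_eq_0_iff:
  fixes t :: "'a::{field,finite} mpoly"
  shows "span_prod s t = 0 \<longleftrightarrow> t \<in> var_span s"
  unfolding span_prod_def prod_zero_iff[OF finite_var_span]
  by (metis add_eq_0_iff add.inverse_inverse var_span_uminus)

text \<open>\<open>W_{s+1}\<close> is the disjoint union of the cosets of \<open>W_s\<close> by the
  multiples of \<open>x_{s+1}\<close>; disjointness holds because \<open>x_{s+1}\<close> is not in
  \<open>W_s\<close>.\<close>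

lemma span_prod_Suc:
  fixes t :: "'a::{field,finite} mpoly"
  shows "span_prod (Suc s) t = (\<Prod>c\<in>UNIV. span_prod s (t + const c * Var (Suc s)))"
proof -
  have "inj_on (\<lambda>(c, v). v + const c * (Var (Suc s) :: 'a mpoly)) (UNIV \<times> var_span s)"
  proof (intro inj_onI, clarify)
    fix c d and u v :: "'a mpoly"
    assume uv: "u \<in> var_span s" "v \<in> var_span s"
      and eq: "u + const c * Var (Suc s) = v + const d * Var (Suc s)"
    have "c = d"
    proof (rule ccontr)
      assume "c \<noteq> d"
      have "const (c - d) * (Var (Suc s) :: 'a mpoly) = const c * Var (Suc s) - const d * Var (Suc s)"
        using const_add[of c "- d"] by (simp add: const_uminus left_diff_distrib)
      also have "\<dots> = v - u" using eq by (simp add: algebra_simps)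
      finally have "const (c - d) * (Var (Suc s) :: 'a mpoly) = v - u" .
      then have "const (inverse (c - d)) * (const (c - d) * Var (Suc s) :: 'a mpoly) \<in> var_span s"
        using uv by (auto intro!: var_span_scale var_span_diff)
      then have "Var (Suc s) \<in> (var_span s :: 'a mpoly set)"
        using \<open>c \<noteq> d\<close> by (simp flip: mult.assoc const_mult)
      then show False using Var_notin_var_span[of s s, where 'a = 'a] by simp
    qed
    then show "c = d \<and> u = v" using eq by simp
  qed
  then show ?thesis
    by (simp add: span_prod_def prod.reindex case_prod_unfold prod.cartesian_product add.assoc add.left_commute
        del: var_span.simps(1))
      (simp add: algebra_simps)
qed

section \<open>Frobenius powers over a field with q elements, q a power of 2\<close>

lemma finite_field_power_card:
  fixes c :: "'a::{field,finite}"
  shows "c ^ card (UNIV :: 'a set) = c"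
proof (cases "c = 0")
  case True
  then show ?thesis by (simp add: card_gt_0_iff)
next
  case False
  let ?U = "UNIV - {0 :: 'a}"
  have "(\<Prod>x\<in>?U. c * x) = \<Prod>?U"
    by (rule prod.reindex_bij_witness[of _ "\<lambda>x. x / c" "\<lambda>x. c * x"]) (use False in auto)
  moreover have "(\<Prod>x\<in>?U. c * x) = c ^ card ?U * \<Prod>?U" by (simp add: prod.distrib)
  moreover have "\<Prod>?U \<noteq> 0" by simp
  ultimately have "c ^ card ?U = 1" by simp
  moreover have "card (UNIV :: 'a set) = Suc (card ?U)"
    by (rule card.remove) auto
  ultimately show ?thesis by (simp only: power_Suc mult_1_right)
qed

lemma finite_field_power_card_power: "c ^ (card (UNIV :: 'a set) ^ k) = c"
  for c :: "'a::{field,finite}"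
  by (induction k) (simp_all add: power_mult finite_field_power_card)

locale binary_field =
  fixes ty :: "'a::{field,finite} itself" and q r :: nat
  assumes card_field: "card (UNIV :: 'a set) = q" and q_def: "q = 2 ^ r"
begin

lemma q_ge_2: "q \<ge> 2"
proof -
  have "card {0, 1 :: 'a} \<le> card (UNIV :: 'a set)" by (rule card_mono) auto
  then show ?thesis by (simp add: card_field)
qed

lemma power_q [simp]: "(c :: 'a) ^ q = c" "(c :: 'a) ^ (q ^ k) = c"
  using finite_field_power_card[of c] finite_field_power_card_power[of c k] by (simp_all add: card_field)

text \<open>The translation \<open>y + 1\<close> permutes the field, so comparing the sums over all
  elements gives \<open>q = 0\<close> in the field, and \<open>q = 2 ^ r\<close> yields
  \<open>2 = 0\<close>.\<close>

lemma char_two: "(x :: 'a) + x = 0"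
proof -
  have "(\<Sum>y\<in>UNIV. y + 1) = (\<Sum>y\<in>UNIV. y :: 'a)"
    by (rule sum.reindex_bij_witness[of _ "\<lambda>y. y - 1" "\<lambda>y. y + 1"]) auto
  then have "of_nat q = (0 :: 'a)" by (simp add: sum.distrib card_field)
  then have "(2 :: 'a) ^ r = 0" by (simp add: q_def)
  then have "(2 :: 'a) = 0" by simp
  then show ?thesis by (metis mult_2 mult_zero_left)
qed

lemma uminus_eq: "- (x :: 'a) = x"
  using char_two[of x] by (simp add: eq_neg_iff_add_eq_0 minus_unique)

lemma mpoly_char_two: "(p :: 'a mpoly) + p = 0"
proof -
  have "p + p = const (1 + 1) * p" by (simp only: const_add const_1 distrib_right mult_1)
  then show ?thesis by (simp only: char_two const_0 mult_zero_left)
qed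

lemma frobenius_two: "((p :: 'a mpoly) + p') ^ (2 ^ k) = p ^ (2 ^ k) + p' ^ (2 ^ k)"
proof (induction k)
  case (Suc k)
  have sq: "x ^ (2 ^ Suc k) = (x ^ (2 ^ k))\<^sup>2" for x :: "'a mpoly"
    by (simp only: power2_eq_square power_add[symmetric] power_Suc mult_2)
  have "(p + p') ^ (2 ^ Suc k) = ((p + p') ^ (2 ^ k))\<^sup>2" by (rule sq)
  also have "\<dots> = (p ^ (2 ^ k))\<^sup>2 + (p' ^ (2 ^ k))\<^sup>2"
    unfolding Suc using mpoly_char_two[of "p ^ (2 ^ k) * p' ^ (2 ^ k)"]
    by (simp add: power2_eq_square algebra_simps)
  finally show ?case unfolding sq .
qed simp

lemma frobenius: "((p :: 'a mpoly) + p') ^ (q ^ k) = p ^ (q ^ k) + p' ^ (q ^ k)"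
  unfolding q_def using frobenius_two[of p p' "r * k"] by (simp add: power_mult)

lemma frobenius_sum: "(\<Sum>i\<in>A. f i :: 'a mpoly) ^ (q ^ k) = (\<Sum>i\<in>A. f i ^ (q ^ k))"
proof (induction A rule: infinite_finite_induct)
  case empty
  have "q ^ k \<noteq> 0" using q_ge_2 by simp
  then show ?case by simp
next
  case (infinite A)
  have "q ^ k \<noteq> 0" using q_ge_2 by simp
  with infinite show ?case by simp
qed (simp add: frobenius)

lemma const_power_q [simp]: "(const c :: 'a mpoly) ^ q = const c" "(const c :: 'a mpoly) ^ (q ^ k) = const c"
  by (simp_all flip: const_power)

text \<open>As polynomials in \<open>x\<close> both sides are monic of degree \<open>q\<close> and
  vanish at the \<open>q\<close> points \<open>c * y\<close>, distinct when \<open>y\<close> is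
  nonzero. Their difference has lower degree and \<open>q\<close> roots, hence is zero.\<close>

lemma prod_add_const_mult:
  fixes x y :: "'a mpoly"
  shows "(\<Prod>c\<in>UNIV. x + const c * y) = x ^ q - y ^ (q - 1) * x"
proof (cases "y = 0")
  case True
  then show ?thesis using q_ge_2 by (simp add: card_field zero_power)
next
  case False
  define A where "A = (\<Prod>c\<in>(UNIV :: 'a set). [:const c * y, 1:])"
  define B where "B = Polynomial.monom 1 q - Polynomial.monom (y ^ (q - 1)) 1"
  have q1: "q - 1 \<noteq> 0" "q \<noteq> 0" "q > 1" using q_ge_2 by auto
  have y_q: "y ^ (q - 1) * y = y ^ q" using q1 power_minus_mult[of q y] by simp
  have A_deg: "Polynomial.degree A = q" "lead_coeff A = 1"
  proof -
    show "lead_coeff A = 1" by (simp add: A_def lead_coeff_prod)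
    show "Polynomial.degree A = q" by (simp add: A_def degree_prod_sum_eq card_field)
  qed
  have B_deg: "Polynomial.degree B = q" "lead_coeff B = 1"
  proof -
    have c: "poly.coeff B q = 1" using q1 by (simp add: B_def)
    moreover have "Polynomial.degree B \<le> q"
      unfolding B_def using q1 by (intro degree_diff_le) (auto intro: order.trans[OF degree_monom_le])
    ultimately show "Polynomial.degree B = q" by (metis le_antisym le_degree zero_neq_one)
    then show "lead_coeff B = 1" using c by simp
  qed
  have "A - B = 0"
  proof (rule ccontr)
    assume nz: "A - B \<noteq> 0"
    have root: "poly (A - B) (const c * y) = 0" for c
    proof -
      have "poly A (const c * y) = 0"
        unfolding A_def poly_prod
        by (rule prod_zero[OF finite], rule bexI[of _ c]) (simp_all add: mpoly_char_two)
      moreover have "poly B (const c * y) = 0"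
        using y_q by (simp add: B_def poly_monom power_mult_distrib mult.left_commute)
      ultimately show ?thesis by simp
    qed
    have "inj (\<lambda>c. const c * y)" using False by (auto simp: inj_def)
    then have "q = card (range (\<lambda>c. const c * y))" by (simp add: card_image card_field)
    also have "\<dots> \<le> card {z. poly (A - B) z = 0}"
      using root by (intro card_mono poly_roots_finite nz) auto
    also have "\<dots> \<le> Polynomial.degree (A - B)" by (rule card_poly_roots_bound[OF nz])
    finally have "q \<le> Polynomial.degree (A - B)" .
    moreover have "Polynomial.degree (A - B) \<le> q"
      using A_deg B_deg by (intro degree_diff_le) auto
    ultimately have "Polynomial.degree (A - B) = q" by simp
    then have "lead_coeff (A - B) = 0" using A_deg B_deg by simp
    then show False using nz leading_coeff_0_iff by blast
  qed
  then have "poly A x = poly B x" by simp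
  then show ?thesis by (simp add: A_def B_def poly_prod poly_monom add.commute)
qed

text \<open>
  The product over a subspace is an additive polynomial: passing from \<open>s\<close> to \<open>s + 1\<close> replaces
  \<open>P(t)\<close> by $\prod_c (P(t) + c P(x)) = P(t)^q - P(x)^{q-1} P(t)$.
\<close>

lemma span_prod_additive:
  obtains c :: "nat \<Rightarrow> 'a mpoly"
  where "\<And>a. c a \<in> polys s" and "\<And>t. span_prod s t = (\<Sum>a\<le>s. c a * t ^ (q ^ a))"
proof -
  have "\<exists>c :: nat \<Rightarrow> 'a mpoly. (\<forall>a. c a \<in> polys s) \<and> (\<forall>t. span_prod s t = (\<Sum>a\<le>s. c a * t ^ (q ^ a)))"
  proof (induction s)
    case 0
    show ?case by (rule exI[of _ "\<lambda>_. 1"]) (simp add: span_prod_def)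
  next
    case (Suc s)
    then obtain c :: "nat \<Rightarrow> 'a mpoly" where c: "\<And>a. c a \<in> polys s"
      and P: "\<And>t. span_prod s t = (\<Sum>a\<le>s. c a * t ^ (q ^ a))" by blast
    define y where "y = span_prod s (Var (Suc s) :: 'a mpoly)"
    \<comment> \<open>Coefficients of \<open>P(t)^q - y^(q-1) * P(t)\<close>: the q-th power shifts
      the index up by one, so the first part is absent at 0 and the second at
      \<open>s + 1\<close>.\<close>
    define d where "d a = (if a = 0 then 0 else c (a - 1) ^ q) - (if a \<le> s then y ^ (q - 1) * c a else 0)" for a
    \<comment> \<open>Scalars pass through because they are fixed by all \<open>q ^ a\<close>-th
      powers; thus \<open>prod_add_const_mult\<close> applies with \<open>P(t)\<close> and
      \<open>y\<close>.\<close>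
    have lin: "span_prod s (t + const e * Var (Suc s)) = span_prod s t + const e * y" for t e
      by (simp add: P y_def frobenius power_mult_distrib sum.distrib sum_distrib_left algebra_simps)
    have y: "y \<in> polys (Suc s)"
      unfolding y_def span_prod_def using var_span_polys[of s] polys_mono[of s "Suc s"]
      by (intro polys_prod polys_add Var_in_polys) auto
    have "d a \<in> polys (Suc s)" for a
    proof -
      have "c b \<in> polys (Suc s)" for b using c polys_mono[of s "Suc s"] by auto
      then show ?thesis using y unfolding d_def
        by (auto intro!: polys_diff polys_uminus polys_mult polys_power)
    qed
    moreover have "span_prod (Suc s) t = (\<Sum>a\<le>Suc s. d a * t ^ (q ^ a))" for t
    proof -
      have "span_prod (Suc s) t = (\<Sum>a\<le>s. c a * t ^ (q ^ a)) ^ q - y ^ (q - 1) * (\<Sum>a\<le>s. c a * t ^ (q ^ a))"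
        unfolding span_prod_Suc lin prod_add_const_mult by (simp only: P)
      also have "(\<Sum>a\<le>s. c a * t ^ (q ^ a)) ^ q = (\<Sum>a\<le>s. c a ^ q * t ^ (q ^ Suc a))"
        using frobenius_sum[of "\<lambda>a. c a * t ^ (q ^ a)" "{..s}" 1]
        by (simp add: power_mult_distrib power_mult[symmetric] mult.commute)
      also have "\<dots> = (\<Sum>a\<le>Suc s. (if a = 0 then 0 else c (a - 1) ^ q) * t ^ (q ^ a))"
        by (subst sum.atMost_Suc_shift) simp
      also have "y ^ (q - 1) * (\<Sum>a\<le>s. c a * t ^ (q ^ a)) =
          (\<Sum>a\<le>Suc s. (if a \<le> s then y ^ (q - 1) * c a else 0) * t ^ (q ^ a))"
        by (simp add: sum_distrib_left mult.assoc)
      finally show ?thesis by (simp add: d_def left_diff_distrib sum_subtractf)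
    qed
    ultimately show ?case by blast
  qed
  then show thesis using that by blast
qed

end

section \<open>The orthogonal group\<close>

text \<open>The bilinear form with matrix \<open>J_{2m}\<close>, which is the polarization of
  \<open>quad_form\<close>.\<close>

definition polar_form :: "nat \<Rightarrow> 'a::comm_ring_1 vec \<Rightarrow> 'a vec \<Rightarrow> 'a" where
  "polar_form m u v = (\<Sum>k<2 * m. u $ k * v $ (2 * m - 1 - k))"

lemma quad_form_lessThan: "quad_form m v = (\<Sum>k<m. v $ (2 * m - 1 - k) * v $ k)"
  using sum.atLeast1_atMost_eq[of "\<lambda>i. v $ (2 * m - i) * v $ (i - 1)" m] by (simp add: quad_form_def)

lemma quad_form_add:
  fixes u v :: "'a::comm_ring_1 vec"
  assumes "u \<in> carrier_vec (2 * m)" "v \<in> carrier_vec (2 * m)"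
  shows "quad_form m (u + v) = quad_form m u + quad_form m v + polar_form m u v"
proof -
  have "polar_form m u v = (\<Sum>k<m. u $ k * v $ (2 * m - 1 - k) + u $ (2 * m - 1 - k) * v $ k)"
    unfolding polar_form_def sum_reflect by (intro sum.cong) auto
  then show ?thesis
    using assms by (simp add: quad_form_lessThan sum.distrib[symmetric] algebra_simps)
qed

lemma O_plusD:
  assumes "g \<in> O_plus m"
  shows "g \<in> carrier (GL (2 * m))" "g \<in> carrier_mat (2 * m) (2 * m)"
    and "\<And>v. v \<in> carrier_vec (2 * m) \<Longrightarrow> quad_form m (g *\<^sub>v v) = quad_form m v"
  using assms GL_carrier_mat by (auto simp: O_plus_def)

lemma O_plus_polar:
  fixes g :: "'a::field mat"
  assumes g: "g \<in> O_plus m" and uv: "u \<in> carrier_vec (2 * m)" "v \<in> carrier_vec (2 * m)"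
  shows "polar_form m (g *\<^sub>v u) (g *\<^sub>v v) = polar_form m u v"
proof -
  have *: "polar_form m u v = quad_form m (u + v) - quad_form m u - quad_form m v"
    if "u \<in> carrier_vec (2 * m)" "v \<in> carrier_vec (2 * m)" for u v :: "'a vec"
    using quad_form_add[OF that] by simp
  have "g *\<^sub>v u \<in> carrier_vec (2 * m)" "g *\<^sub>v v \<in> carrier_vec (2 * m)"
    using O_plusD(2)[OF g] uv by auto
  moreover have "g *\<^sub>v u + g *\<^sub>v v = g *\<^sub>v (u + v)"
    using O_plusD(2)[OF g] uv by (simp add: mult_add_distrib_mat_vec)
  ultimately show ?thesis
    using uv O_plusD(3)[OF g] by (simp add: *)
qed

lemma mult_unit_vec_index:
  assumes "(g :: 'a::semiring_1 mat) \<in> carrier_mat n n" "k < n" "a < n"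
  shows "(g *\<^sub>v unit_vec n a) $ k = g $$ (k, a)"
  using assms by (simp add: scalar_prod_right_unit[of _ n])

text \<open>The columns of \<open>g\<close> are the images of the standard basis, a hyperbolic
  basis: each column is singular for the quadratic form, and columns pair as the basis vectors
  do.\<close>

lemma
  fixes g :: "'a::field mat"
  assumes g: "g \<in> O_plus m"
  shows O_plus_quad_entries: "a < 2 * m \<Longrightarrow> (\<Sum>k<m. g $$ (2 * m - 1 - k, a) * g $$ (k, a)) = 0"
    and O_plus_polar_entries: "a < 2 * m \<Longrightarrow> b < 2 * m \<Longrightarrow>
      (\<Sum>k<2 * m. g $$ (k, a) * g $$ (2 * m - 1 - k, b)) = (if a + b + 1 = 2 * m then 1 else 0)"
proof -
  note gm = O_plusD(2)[OF g]
  show "(\<Sum>k<m. g $$ (2 * m - 1 - k, a) * g $$ (k, a)) = 0" if a: "a < 2 * m"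
  proof -
    have "(\<Sum>k<m. g $$ (2 * m - 1 - k, a) * g $$ (k, a)) = quad_form m (g *\<^sub>v unit_vec (2 * m) a)"
      unfolding quad_form_lessThan using a
      by (intro sum.cong refl) (simp add: mult_unit_vec_index[OF gm] del: index_mult_mat_vec)
    also have "\<dots> = quad_form m (unit_vec (2 * m) a)" by (rule O_plusD(3)[OF g]) simp
    also have "\<dots> = 0"
      unfolding quad_form_lessThan using a by (intro sum.neutral) (auto simp: unit_vec_def)
    finally show ?thesis .
  qed
  show "(\<Sum>k<2 * m. g $$ (k, a) * g $$ (2 * m - 1 - k, b)) = (if a + b + 1 = 2 * m then 1 else 0)"
    if a: "a < 2 * m" and b: "b < 2 * m"
  proof -
    have "(\<Sum>k<2 * m. g $$ (k, a) * g $$ (2 * m - 1 - k, b)) =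
        polar_form m (g *\<^sub>v unit_vec (2 * m) a) (g *\<^sub>v unit_vec (2 * m) b)"
      unfolding polar_form_def using a b
      by (intro sum.cong refl) (simp add: mult_unit_vec_index[OF gm] del: index_mult_mat_vec)
    also have "\<dots> = polar_form m (unit_vec (2 * m) a) (unit_vec (2 * m) b)"
      by (rule O_plus_polar[OF g]) simp_all
    also have "\<dots> = (\<Sum>k<2 * m. if k = a then if a + b + 1 = 2 * m then 1 else 0 else 0)"
      unfolding polar_form_def using a b by (intro sum.cong refl) (auto simp: unit_vec_def)
    finally show ?thesis using a by simp
  qed
qed

text \<open>Preserving the polar form makes \<open>J g^T J\<close> the inverse of \<open>g\<close>;
  its entries are those of \<open>g\<close> reflected in the antidiagonal.\<close>

lemma O_plus_inverse:
  fixes g :: "'a::field mat"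
  assumes g: "g \<in> O_plus m"
  shows "inv\<^bsub>GL (2 * m)\<^esub> g \<in> O_plus m"
    and "i < 2 * m \<Longrightarrow> j < 2 * m \<Longrightarrow>
      (inv\<^bsub>GL (2 * m)\<^esub> g) $$ (i, j) = g $$ (2 * m - 1 - j, 2 * m - 1 - i)"
proof -
  note gG = O_plusD(1)[OF g] and gm = O_plusD(2)[OF g]
  note h = GL_inverse[OF gG]
  note hm = GL_carrier_mat[OF h(1)]
  show "inv\<^bsub>GL (2 * m)\<^esub> g \<in> O_plus m"
    unfolding O_plus_def
  proof (intro CollectI conjI ballI)
    fix v :: "'a vec" assume v: "v \<in> carrier_vec (2 * m)"
    have "quad_form m (g *\<^sub>v (inv\<^bsub>GL (2 * m)\<^esub> g *\<^sub>v v)) = quad_form m (inv\<^bsub>GL (2 * m)\<^esub> g *\<^sub>v v)"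
      by (rule O_plusD(3)[OF g]) (use hm v in auto)
    moreover have "g *\<^sub>v (inv\<^bsub>GL (2 * m)\<^esub> g *\<^sub>v v) = v"
      using assoc_mult_mat_vec[OF gm hm v] h(3) v by simp
    ultimately show "quad_form m (inv\<^bsub>GL (2 * m)\<^esub> g *\<^sub>v v) = quad_form m v" by simp
  qed (rule h(1))
  show "(inv\<^bsub>GL (2 * m)\<^esub> g) $$ (i, j) = g $$ (2 * m - 1 - j, 2 * m - 1 - i)" if ij: "i < 2 * m" "j < 2 * m"
  proof -
    let ?t = "mat (2 * m) (2 * m) (\<lambda>(i, j). g $$ (2 * m - 1 - j, 2 * m - 1 - i))"
    have "inv\<^bsub>GL (2 * m)\<^esub> g = ?t"
    proof (rule GL_inverse_unique[OF gG])
      show "?t * g = 1\<^sub>m (2 * m)"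
      proof (rule eq_matI)
        fix i j assume "i < dim_row (1\<^sub>m (2 * m) :: 'a mat)" "j < dim_col (1\<^sub>m (2 * m) :: 'a mat)"
        then have ij: "i < 2 * m" "j < 2 * m" by auto
        have "(?t * g) $$ (i, j) = (\<Sum>k<2 * m. g $$ (k, j) * g $$ (2 * m - 1 - k, 2 * m - 1 - i))"
          using ij gm by (simp add: scalar_prod_def lessThan_atLeast0 mult.commute)
        also have "\<dots> = (if i = j then 1 else 0)"
          using ij by (subst O_plus_polar_entries[OF g]) auto
        finally show "(?t * g) $$ (i, j) = 1\<^sub>m (2 * m) $$ (i, j)" using ij by simp
      qed (use gm in auto)
    qed simp
    then show ?thesis using ij by simp
  qed
qed

lemma one_in_O_plus: "1\<^sub>m (2 * m) \<in> O_plus m"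
  by (auto simp: O_plus_def carrier_GL)

section \<open>The forms \<open>h_k\<close> and their invariance under the orthogonal group\<close>

lemma h_poly_1: "h_poly q m 1 = (\<Sum>k<m. Var (Suc (2 * m - 1 - k)) * Var (Suc k))"
  unfolding h_poly_def if_P[OF refl]
  using sum.atLeast1_atMost_eq[of "\<lambda>i. Var (2 * m - i + 1) * Var i :: 'a mpoly" m]
  by (simp add: Suc_diff_Suc)

lemma h_poly_2:
  "j \<noteq> 1 \<Longrightarrow> h_poly q m j = (\<Sum>k<m. Var (Suc (2 * m - 1 - k)) ^ (q ^ (j - 1)) * Var (Suc k) +
     Var (Suc (2 * m - 1 - k)) * Var (Suc k) ^ (q ^ (j - 1)))"
  unfolding h_poly_def if_not_P
  using sum.atLeast1_atMost_eq[of "\<lambda>i. Var (2 * m - i + 1) ^ (q ^ (j - 1)) * Var i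
                      + Var (2 * m - i + 1) * Var i ^ (q ^ (j - 1)) :: 'a mpoly" m]
  by (simp add: Suc_diff_Suc)

lemma h_poly_in_polys: "h_poly q m j \<in> polys (2 * m)" for q :: nat
  by (cases "j = 1") (simp_all add: h_poly_1[unfolded One_nat_def] h_poly_2[unfolded One_nat_def],
      (intro polys_sum polys_mult polys_add polys_power Var_in_polys; auto)+)

text \<open>Collects the coefficient matrix of a bilinear expression after a linear substitution.
  Two families \<open>x\<close> and \<open>y\<close> are allowed so that one of them can consist of
  Frobenius powers.\<close>

lemma sum_mat_product:
  fixes M :: "'a::field mat" and x y :: "nat \<Rightarrow> 'a mpoly"
  shows "(\<Sum>k\<in>A. (\<Sum>a<n. const (M $$ (f k, a)) * x a) * (\<Sum>b<n. const (M $$ (e k, b)) * y b)) =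
     (\<Sum>a<n. \<Sum>b<n. const (\<Sum>k\<in>A. M $$ (f k, a) * M $$ (e k, b)) * (x a * y b))"
proof -
  have "(\<Sum>k\<in>A. (\<Sum>a<n. const (M $$ (f k, a)) * x a) * (\<Sum>b<n. const (M $$ (e k, b)) * y b)) =
      (\<Sum>k\<in>A. \<Sum>a<n. \<Sum>b<n. const (M $$ (f k, a) * M $$ (e k, b)) * (x a * y b))"
    by (simp add: sum_product const_mult mult_ac)
  also have "\<dots> = (\<Sum>a<n. \<Sum>b<n. \<Sum>k\<in>A. const (M $$ (f k, a) * M $$ (e k, b)) * (x a * y b))"
    by (subst sum.swap) (intro sum.cong refl sum.swap)
  finally show ?thesis by (simp add: const_sum sum_distrib_right)
qed

text \<open>
  As a polynomial identity (not only as functions on \<open>V\<close>), invariance of $h_1$ under $g$ means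
  that the coefficient matrix of $h_1 \circ g^{-1}$ differs from that of $h_1$ by an alternating one.
\<close>

lemma act_h_poly_1:
  fixes g :: "'a::field mat"
  assumes g: "g \<in> O_plus m"
  shows "act_poly g (h_poly q m 1) = h_poly q m 1"
proof -
  let ?n = "2 * m"
  let ?V = "\<lambda>a. Var (Suc a) :: 'a mpoly"
  let ?Q = "\<lambda>M :: 'a mat. \<lambda>a b. \<Sum>k<m. M $$ (?n - 1 - k, a) * M $$ (k, b)"
  let ?S = "\<lambda>M. \<Sum>k<m. (\<Sum>a<?n. const (M $$ (?n - 1 - k, a)) * ?V a) * (\<Sum>b<?n. const (M $$ (k, b)) * ?V b)"
  have S: "?S M = (\<Sum>a<?n. \<Sum>b<?n. const (?Q M a b) * (?V a * ?V b))" for M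
    by (rule sum_mat_product)
  have Q1: "?Q M a a = 0" if "M \<in> O_plus m" "a < ?n" for M a
    using O_plus_quad_entries[OF that] by simp
  have Q2: "?Q M a b + ?Q M b a = (if a + b + 1 = ?n then 1 else 0)"
    if M: "M \<in> O_plus m" and ab: "a < ?n" "b < ?n" for M a b
  proof -
    have "?Q M a b + ?Q M b a = (\<Sum>k<?n. M $$ (k, a) * M $$ (?n - 1 - k, b))"
      unfolding sum_reflect sum.distrib[symmetric] by (intro sum.cong refl) (auto simp: algebra_simps)
    then show ?thesis using O_plus_polar_entries[OF M ab] by simp
  qed
  \<comment> \<open>Comparing two orthogonal matrices makes the difference alternating; with
    \<open>N\<close> the identity, \<open>?S N\<close> is \<open>h_1\<close> itself.\<close>
  have indep: "?S M - ?S N = 0" if M: "M \<in> O_plus m" and N: "N \<in> O_plus m" for M N :: "'a mat"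
  proof -
    have "?S M - ?S N = (\<Sum>a<?n. \<Sum>b<?n. const (?Q M a b - ?Q N a b) * (?V a * ?V b))"
      by (simp only: S const_diff left_diff_distrib sum_subtractf)
    also have "\<dots> = 0"
    proof (rule alternating_sum_eq_0)
      show "const (?Q M a a - ?Q N a a) = 0" if "a < ?n" for a using Q1 that M N by simp
      show "const (?Q M a b - ?Q N a b) + const (?Q M b a - ?Q N b a) = 0" if "a < ?n" "b < ?n" for a b
      proof -
        have "?Q M a b - ?Q N a b + (?Q M b a - ?Q N b a) = 0"
          using Q2[OF M that] Q2[OF N that] by (simp add: algebra_simps)
        then show ?thesis by (simp flip: const_add)
      qed
    qed
    finally show ?thesis .
  qed
  have id: "(\<Sum>a<?n. const (1\<^sub>m ?n $$ (k, a)) * ?V a) = ?V k" if "k < ?n" for k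
  proof -
    have "(\<Sum>a<?n. const (1\<^sub>m ?n $$ (k, a)) * ?V a) = (\<Sum>a<?n. if a = k then ?V a else 0)"
      using that by (intro sum.cong refl) auto
    then show ?thesis using that by simp
  qed
  have "act_poly g (h_poly q m 1) = ?S (inv\<^bsub>GL ?n\<^esub> g)"
    unfolding h_poly_1 act_poly_sum act_poly_simps act_var_Suc[OF O_plusD(1)[OF g]] by simp
  also have "\<dots> = ?S (1\<^sub>m ?n)"
    using indep[OF O_plus_inverse(1)[OF g] one_in_O_plus] by simp
  also have "\<dots> = h_poly q m 1"
    unfolding h_poly_1 by (intro sum.cong refl arg_cong2[of _ _ _ _ "(*)"] id) auto
  finally show ?thesis .
qed

locale even_orthogonal = binary_field ty q r for ty :: "'a::{field,finite} itself" and q r +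
  fixes m :: nat
  assumes m_pos: "m \<ge> 1"
begin

text \<open>Indices start at 0 as for matrices: \<open>\<xi> i\<close> is the variable with number
  \<open>i + 1\<close>, and \<open>refl_ix i\<close> is the index of its hyperbolic partner.\<close>

abbreviation n :: nat where "n \<equiv> 2 * m"
abbreviation refl_ix :: "nat \<Rightarrow> nat" where "refl_ix i \<equiv> 2 * m - 1 - i"
abbreviation \<xi> :: "nat \<Rightarrow> 'a mpoly" where "\<xi> i \<equiv> Var (Suc i)"

text \<open>For \<open>j\<close> other than 1 the form is the polar form of the vector of Frobenius
  powers with the vector of variables. Matrix entries are fixed by Frobenius, so both vectors
  transform by the same matrix.\<close>

lemma act_h_poly:
  assumes g: "(g :: 'a mat) \<in> O_plus m"
  shows "act_poly g (h_poly q m j) = h_poly q m j"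
proof (cases "j = 1")
  case True
  then show ?thesis using act_h_poly_1[OF g] by simp
next
  case False
  let ?Q = "q ^ (j - 1)"
  let ?M = "inv\<^bsub>GL n\<^esub> g"
  have h: "h_poly q m j = (\<Sum>k<n. \<xi> k ^ ?Q * \<xi> (refl_ix k))"
    unfolding h_poly_2[OF False] sum_reflect by (intro sum.cong refl) (auto simp: algebra_simps)
  have "act_poly g (h_poly q m j) = (\<Sum>k<n. (\<Sum>a<n. const (?M $$ (k, a)) * \<xi> a ^ ?Q) *
      (\<Sum>b<n. const (?M $$ (refl_ix k, b)) * \<xi> b))"
    unfolding h act_poly_sum act_poly_simps act_var_Suc[OF O_plusD(1)[OF g]]
    by (simp add: frobenius_sum power_mult_distrib)
  also have "\<dots> = (\<Sum>a<n. \<Sum>b<n. const (\<Sum>k<n. ?M $$ (k, a) * ?M $$ (refl_ix k, b)) * (\<xi> a ^ ?Q * \<xi> b))"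
    by (rule sum_mat_product)
  also have "\<dots> = (\<Sum>a<n. \<Sum>b<n. if b = refl_ix a then \<xi> a ^ ?Q * \<xi> b else 0)"
  proof (intro sum.cong refl)
    fix a b assume ab: "a \<in> {..<n}" "b \<in> {..<n}"
    then have "(a + b + 1 = n) \<longleftrightarrow> b = refl_ix a" by auto
    then have "(\<Sum>k<n. ?M $$ (k, a) * ?M $$ (refl_ix k, b)) = (if b = refl_ix a then 1 else 0)"
      using O_plus_polar_entries[OF O_plus_inverse(1)[OF g], of a b] ab by simp
    then show "const (\<Sum>k<n. ?M $$ (k, a) * ?M $$ (refl_ix k, b)) * (\<xi> a ^ ?Q * \<xi> b) =
        (if b = refl_ix a then \<xi> a ^ ?Q * \<xi> b else 0)"
      by (cases "b = refl_ix a") (simp_all only: if_True if_False simp_thms const_0 const_1 mult_1 mult_zero_left)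
  qed
  also have "\<dots> = (\<Sum>a<n. \<xi> a ^ ?Q * \<xi> (refl_ix a))"
    by (intro sum.cong refl) auto
  finally show ?thesis by (simp add: h)
qed

section \<open>The group \<open>G_1\<close> in terms of matrix entries\<close>

lemma antidiag_mat_mult:
  "A \<in> carrier_mat k k' \<Longrightarrow> antidiag_mat k * A = mat k k' (\<lambda>(i, j). A $$ (k - 1 - i, j) :: 'b::comm_ring_1)"
proof (rule eq_matI)
  fix i j assume A: "A \<in> carrier_mat k k'" and "i < dim_row (mat k k' (\<lambda>(i, j). A $$ (k - 1 - i, j)))"
    "j < dim_col (mat k k' (\<lambda>(i, j). A $$ (k - 1 - i, j)))"
  then have ij: "i < k" "j < k'" by auto
  have "(antidiag_mat k * A) $$ (i, j) = (\<Sum>l<k. if l = k - 1 - i then A $$ (l, j) else 0)"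
  proof -
    have "(antidiag_mat k * A) $$ (i, j) = (\<Sum>l<k. (if i + l + 1 = k then 1 else 0) * A $$ (l, j))"
      using ij A by (simp add: antidiag_mat_def scalar_prod_def lessThan_atLeast0)
    also have "\<dots> = (\<Sum>l<k. if l = k - 1 - i then A $$ (l, j) else 0)"
      using ij by (intro sum.cong refl) auto
    finally show ?thesis .
  qed
  then show "(antidiag_mat k * A) $$ (i, j) = mat k k' (\<lambda>(i, j). A $$ (k - 1 - i, j)) $$ (i, j)"
    using ij by simp
qed (auto simp: antidiag_mat_def)

text \<open>Lower unitriangularity gives the block shape up to the middle \<open>I_2\<close>, whose
  entry below the diagonal has the 0-based position \<open>(m, m - 1)\<close>. The conditions on
  \<open>J\<close> and \<open>S\<close> are read off from the columns of an orthogonal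
  matrix.\<close>

lemma G1_iff:
  "(N :: 'a mat) \<in> G1 m \<longleftrightarrow> N \<in> O_plus m \<and> N \<in> lower_unitri n \<and> N $$ (m, m - 1) = 0"
proof (intro iffI conjI)
  assume "N \<in> G1 m"
  then show "N \<in> O_plus m" "N \<in> lower_unitri n" by (auto simp: G1_def)
  from \<open>N \<in> G1 m\<close> obtain A B C D E where blocks: "A \<in> lower_unitri (m - 1)" "B \<in> carrier_mat 2 (m - 1)"
      "C \<in> carrier_mat (m - 1) (m - 1)" "D \<in> carrier_mat (m - 1) 2"
      "E \<in> lower_unitri (m - 1)" "N = block_lower m A B C D E"
    unfolding G1_def by blast
  then show "N $$ (m, m - 1) = 0"
    using m_pos by (auto simp: block_lower_def append_rows_def lower_unitri_def)
next
  assume *: "N \<in> O_plus m \<and> N \<in> lower_unitri n \<and> N $$ (m, m - 1) = 0"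
  then have O: "N \<in> O_plus m" and U: "N \<in> lower_unitri n" and z: "N $$ (m, m - 1) = 0" by auto
  have Nm: "N \<in> carrier_mat n n" using U by (simp add: lower_unitri_def)
  let ?k = "m - 1"
  define A where "A = mat ?k ?k (\<lambda>(i, j). N $$ (i, j))"
  define B where "B = mat 2 ?k (\<lambda>(i, j). N $$ (?k + i, j))"
  define C where "C = mat ?k ?k (\<lambda>(i, j). N $$ (m + 1 + i, j))"
  define D where "D = mat ?k 2 (\<lambda>(i, j). N $$ (m + 1 + i, ?k + j))"
  define E where "E = mat ?k ?k (\<lambda>(i, j). N $$ (m + 1 + i, m + 1 + j))"
  note defs = A_def B_def C_def D_def E_def
  have dims: "dim_row A = ?k" "dim_col A = ?k" "dim_row B = 2" "dim_col B = ?k" "dim_row C = ?k"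
    "dim_col C = ?k" "dim_row D = ?k" "dim_col D = 2" "dim_row E = ?k" "dim_col E = ?k"
    by (simp_all add: defs)
  have BCD: "B \<in> carrier_mat 2 ?k" "C \<in> carrier_mat ?k ?k" "D \<in> carrier_mat ?k 2"
    by (simp_all add: defs)
  have U1: "N $$ (i, i) = 1" if "i < n" for i using U that by (simp add: lower_unitri_def)
  have U0: "N $$ (i, j) = 0" if "i < j" "j < n" for i j using U that by (simp add: lower_unitri_def)
  have AE: "A \<in> lower_unitri ?k" "E \<in> lower_unitri ?k"
    using U1 U0 by (auto simp: lower_unitri_def A_def E_def)
  have N: "N = block_lower m A B C D E"
  proof (rule eq_matI)
    fix i j assume "i < dim_row (block_lower m A B C D E)" "j < dim_col (block_lower m A B C D E)"
    then have ij: "i < n" "j < n" using m_pos by (auto simp: block_lower_def append_rows_def dims)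
    consider "i < ?k" | "i = ?k" | "i = m" | "i > m" using m_pos by linarith
    then show "N $$ (i, j) = block_lower m A B C D E $$ (i, j)"
    proof cases
      case 1
      then show ?thesis using ij m_pos U0
        by (auto simp: block_lower_def append_rows_def dims) (simp add: A_def)
    next
      case 2
      have "j < ?k \<or> j = ?k \<or> j > ?k" by linarith
      then show ?thesis using 2 ij m_pos U0 U1
        by (elim disjE) (auto simp: block_lower_def append_rows_def dims B_def)
    next
      case 3
      have "j < ?k \<or> j = ?k \<or> j = m \<or> j > m" by linarith
      then show ?thesis using 3 ij m_pos U0 U1 z
        by (elim disjE) (auto simp: block_lower_def append_rows_def dims B_def)
    next
      case 4
      then have "m + 1 + (i - ?k - 2) = i" "?k + (j - ?k) = j \<or> j < ?k" "m + 1 + (j - ?k - 2) = j \<or> j \<le> m"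
        using m_pos by auto
      then show ?thesis using ij m_pos 4
        by (auto simp: block_lower_def append_rows_def dims) (auto simp: C_def D_def E_def)+
    qed
  qed (use Nm m_pos in \<open>auto simp: block_lower_def append_rows_def dims\<close>)
  have J: "N\<^sup>T * antidiag_mat n * N = antidiag_mat n"
  proof -
    have "N\<^sup>T * antidiag_mat n * N = N\<^sup>T * (antidiag_mat n * N)"
      using Nm by (intro assoc_mult_mat[of _ n n _ n _ n]) (auto simp: antidiag_mat_def)
    also have "\<dots> = antidiag_mat n"
    proof (rule eq_matI)
      fix i j assume "i < dim_row (antidiag_mat n :: 'a mat)" "j < dim_col (antidiag_mat n :: 'a mat)"
      then have ij: "i < n" "j < n" by (auto simp: antidiag_mat_def)
      have "(N\<^sup>T * (antidiag_mat n * N)) $$ (i, j) = (\<Sum>k<n. N $$ (k, i) * N $$ (n - 1 - k, j))"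
        unfolding antidiag_mat_mult[OF Nm] using ij Nm by (simp add: scalar_prod_def lessThan_atLeast0)
      then show "(N\<^sup>T * (antidiag_mat n * N)) $$ (i, j) = antidiag_mat n $$ (i, j)"
        using O_plus_polar_entries[OF O ij] ij by (simp add: antidiag_mat_def)
    qed (use Nm in \<open>auto simp: antidiag_mat_def\<close>)
    finally show ?thesis .
  qed
  have S: "(A\<^sup>T * antidiag_mat ?k * C) $$ (i, i) = B $$ (0, i) * B $$ (1, i)" if i: "i < ?k" for i
  proof -
    have "A\<^sup>T * antidiag_mat ?k * C = A\<^sup>T * (antidiag_mat ?k * C)"
      by (intro assoc_mult_mat[of _ ?k ?k _ ?k _ ?k]) (auto simp: antidiag_mat_def A_def C_def)
    then have "(A\<^sup>T * antidiag_mat ?k * C) $$ (i, i) = (\<Sum>k<?k. A $$ (k, i) * C $$ (?k - 1 - k, i))"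
      unfolding antidiag_mat_mult[OF BCD(2)] using i
      by (simp add: scalar_prod_def lessThan_atLeast0 dims)
    also have "\<dots> = (\<Sum>k<?k. N $$ (n - 1 - k, i) * N $$ (k, i))"
    proof (intro sum.cong refl)
      fix k assume "k \<in> {..<?k}"
      moreover then have "m + 1 + (?k - 1 - k) = n - 1 - k" by auto
      ultimately show "A $$ (k, i) * C $$ (?k - 1 - k, i) = N $$ (n - 1 - k, i) * N $$ (k, i)"
        using i by (simp add: A_def C_def mult.commute)
    qed
    \<comment> \<open>Column \<open>i\<close> is singular: the terms below \<open>m - 1\<close> make
      up \<open>s_ii\<close>, and the one remaining term is the product of the two middle entries,
      those of \<open>B\<close>. The sign disappears in characteristic 2.\<close>
    also have "\<dots> = - (N $$ (m, i) * N $$ (?k, i))"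
    proof -
      have "{..<m} = insert ?k {..<?k}" "n - 1 - ?k = m" using m_pos by auto
      then show ?thesis
        using O_plus_quad_entries[OF O, of i] i by (simp add: add_eq_0_iff)
    qed
    also have "\<dots> = B $$ (0, i) * B $$ (1, i)"
      using i m_pos by (simp add: B_def uminus_eq mult.commute)
    finally show ?thesis .
  qed
  show "N \<in> G1 m"
    unfolding G1_def Let_def using O U AE BCD N J S by blast
qed

lemma G1_carrier: "G1 m \<subseteq> carrier (GL n :: 'a mat monoid)"
  using O_plusD(1) by (auto simp: G1_iff)

text \<open>The inverse, being the antidiagonal reflection, is again lower unitriangular. The
  position \<open>(m, m - 1)\<close> is fixed by this reflection, so \<open>\<xi> m\<close> does not
  pick up \<open>\<xi> (m - 1)\<close>.\<close>

lemma act_var_G1: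
  assumes g: "g \<in> G1 m" and i: "i < n"
  obtains w where "w \<in> var_span (if i = m then m - 1 else i)" "act_poly g (\<xi> i) = \<xi> i + w"
proof -
  let ?M = "inv\<^bsub>GL n\<^esub> g"
  have g': "g \<in> O_plus m" "g \<in> lower_unitri n" "g $$ (m, m - 1) = 0" using g by (auto simp: G1_iff)
  have M: "?M $$ (i, j) = g $$ (refl_ix j, refl_ix i)" if "j < n" for j
    using O_plus_inverse(2)[OF g'(1) i that] .
  have M1: "?M $$ (i, i) = 1" using M[OF i] g'(2) i by (simp add: lower_unitri_def)
  have M0: "?M $$ (i, j) = 0" if "i < j" "j < n" for j
    using M[OF that(2)] g'(2) that by (simp add: lower_unitri_def)
  have Mm: "?M $$ (i, m - 1) = 0" if "i = m"
    using M[of "m - 1"] g'(3) that m_pos by simp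
  let ?f = "\<lambda>j. const (?M $$ (i, j)) * \<xi> j"
  have "act_poly g (\<xi> i) = sum ?f {..<n}"
    unfolding act_poly_simps by (rule act_var_Suc[OF O_plusD(1)[OF g'(1)]])
  also have "\<dots> = sum ?f {..<Suc i}"
    using i by (intro sum.mono_neutral_right) (auto simp: M0)
  also have "\<dots> = sum ?f {..<i} + \<xi> i" by (simp add: M1)
  finally have "act_poly g (\<xi> i) = \<xi> i + sum ?f {..<i}" by (simp add: add.commute)
  moreover have "sum ?f {..<i} \<in> var_span (if i = m then m - 1 else i)"
  proof (intro var_span_sum)
    fix j assume "j \<in> {..<i}"
    then have "?f j = 0 \<or> j < (if i = m then m - 1 else i)"
      using Mm by (cases "i = m \<and> j = m - 1") auto
    then show "?f j \<in> var_span (if i = m then m - 1 else i)"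
      using var_span_scale[OF Var_in_var_span] var_span_0 by metis
  qed
  ultimately show thesis using that by blast
qed

end

section \<open>Siegel transformations and orbit products\<close>

context even_orthogonal
begin

text \<open>The \<open>s_i\<close> of the overview; the \<open>- 1\<close> there is absorbed by
  counting from 0.\<close>

abbreviation rank_ix :: "nat \<Rightarrow> nat" where "rank_ix i \<equiv> min i (refl_ix i)"

text \<open>A Siegel (Eichler) transformation. The second summand adds the combination of
  \<open>x_l\<close>, \<open>l < rank_ix i\<close>, to coordinate \<open>i\<close>; the third adds
  multiples of the partner of coordinate \<open>i\<close> to the partners of these
  \<open>x_l\<close>, which restores the quadratic form.\<close>

definition siegel :: "nat \<Rightarrow> (nat \<Rightarrow> 'a) \<Rightarrow> 'a mat" where
  "siegel i c = mat n n (\<lambda>(k, l). (if k = l then 1 else 0) +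
     (if k = i \<and> l < rank_ix i then c l else 0) +
     (if l = refl_ix i \<and> refl_ix k < rank_ix i then c (refl_ix k) else 0))"

lemma siegel_carrier: "siegel i c \<in> carrier_mat n n"
  by (simp add: siegel_def)

text \<open>Stated for an additive \<open>f\<close> so that the same computation serves vectors
  (\<open>f\<close> the identity) and variables (\<open>f = const\<close>).\<close>

lemma sum_siegel:
  fixes f :: "'a \<Rightarrow> 'b::comm_ring_1"
  assumes "i < n" "k < n" and f: "f 0 = 0" "f 1 = 1" "\<And>a b. f (a + b) = f a + f b"
  shows "(\<Sum>l<n. f (siegel i c $$ (k, l)) * x l) =
     x k + (if k = i then \<Sum>l<rank_ix i. f (c l) * x l else 0) +
     (if refl_ix k < rank_ix i then f (c (refl_ix k)) * x (refl_ix i) else 0)"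
proof -
  have "(\<Sum>l<n. f (siegel i c $$ (k, l)) * x l) =
     (\<Sum>l<n. (if l = k then x l else 0) + (if l \<in> {..<rank_ix i} then if k = i then f (c l) * x l else 0 else 0) +
       (if l = refl_ix i then if refl_ix k < rank_ix i then f (c (refl_ix k)) * x l else 0 else 0))"
    using assms(1,2) by (intro sum.cong refl) (auto simp: siegel_def f algebra_simps)
  also have "\<dots> = x k + (\<Sum>l<rank_ix i. if k = i then f (c l) * x l else 0) +
     (if refl_ix k < rank_ix i then f (c (refl_ix k)) * x (refl_ix i) else 0)"
  proof -
    have "{..<n} \<inter> {..<rank_ix i} = {..<rank_ix i}" using assms(1) by auto
    then show ?thesis
      using assms(1,2) unfolding sum.distrib sum.inter_restrict[OF finite_lessThan, symmetric]
      by simp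
  qed
  finally show ?thesis by simp
qed

lemma siegel_mult_vec:
  assumes "i < n" "k < n" "v \<in> carrier_vec n"
  shows "(siegel i c *\<^sub>v v) $ k =
     v $ k + (if k = i then \<Sum>l<rank_ix i. c l * v $ l else 0) +
     (if refl_ix k < rank_ix i then c (refl_ix k) * v $ refl_ix i else 0)"
proof -
  have "(siegel i c *\<^sub>v v) $ k = (\<Sum>l<n. siegel i c $$ (k, l) * v $ l)"
    using assms siegel_carrier[of i c] by (simp add: scalar_prod_def lessThan_atLeast0)
  then show ?thesis using sum_siegel[OF assms(1,2), of "\<lambda>a. a" c "\<lambda>l. v $ l"] by simp
qed

text \<open>The coordinates that are read, \<open>l < rank_ix i\<close> and
  \<open>refl_ix i\<close>, are not changed. A second application therefore adds the same terms
  again, and they cancel in characteristic 2.\<close>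

lemma siegel_square:
  assumes i: "i < n"
  shows "siegel i c * siegel i c = 1\<^sub>m n"
proof (rule eq_matI)
  fix k j assume "k < dim_row (1\<^sub>m n :: 'a mat)" "j < dim_col (1\<^sub>m n :: 'a mat)"
  then have kj: "k < n" "j < n" by auto
  define v :: "'a vec" where "v = unit_vec n j"
  define w where "w = siegel i c *\<^sub>v v"
  have v: "v \<in> carrier_vec n" by (simp add: v_def)
  have w: "w \<in> carrier_vec n" unfolding w_def using siegel_carrier v by (rule mult_mat_vec_carrier)
  have w_small: "w $ l = v $ l" if "l < rank_ix i" for l
    using siegel_mult_vec[OF i _ v, of l c] that i by (auto simp: w_def)
  \<comment> \<open>By parity \<open>refl_ix i\<close> differs from \<open>i\<close>, since their
    sum \<open>2 * m - 1\<close> is odd.\<close>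
  have w_refl: "w $ refl_ix i = v $ refl_ix i"
    using siegel_mult_vec[OF i _ v, of "refl_ix i" c] i by (auto simp: w_def) presburger+
  have "(siegel i c * siegel i c) $$ (k, j) = ((siegel i c * siegel i c) *\<^sub>v v) $ k"
    using mult_unit_vec_index[OF mult_carrier_mat[OF siegel_carrier siegel_carrier] kj] by (simp add: v_def)
  also have "\<dots> = (siegel i c *\<^sub>v w) $ k"
    unfolding w_def using assoc_mult_mat_vec[OF siegel_carrier siegel_carrier v] by simp
  also have "\<dots> = w $ k + (if k = i then \<Sum>l<rank_ix i. c l * v $ l else 0) +
     (if refl_ix k < rank_ix i then c (refl_ix k) * v $ refl_ix i else 0)"
    unfolding siegel_mult_vec[OF i kj(1) w] w_refl using w_small by simp
  also have "\<dots> = v $ k"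
  proof -
    have "(x + a + b) + a + b = x" for x a b :: 'a
    proof -
      have "(x + a + b) + a + b = x + (a + a) + (b + b)" by (simp only: add_ac)
      then show ?thesis by (simp only: char_two add_0_right)
    qed
    then show ?thesis unfolding w_def siegel_mult_vec[OF i kj(1) v] .
  qed
  finally show "(siegel i c * siegel i c) $$ (k, j) = 1\<^sub>m n $$ (k, j)"
    using kj by (auto simp: v_def)
qed (use siegel_carrier in auto)

lemma siegel_GL: "i < n \<Longrightarrow> siegel i c \<in> carrier (GL n)"
  unfolding carrier_GL by (intro conjI bexI[of _ "siegel i c"] siegel_carrier siegel_square)

lemma siegel_inverse: "i < n \<Longrightarrow> inv\<^bsub>GL n\<^esub> (siegel i c) = siegel i c"
  by (rule GL_inverse_unique[OF siegel_GL siegel_carrier siegel_square])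

text \<open>The change of coordinate \<open>i\<close> contributes \<open>?c * v $ refl_ix i\<close>;
  the compensating changes of the partners contribute the same amount in total, and the two
  cancel.\<close>

lemma quad_form_siegel:
  assumes i: "i < n" and v: "v \<in> carrier_vec n"
  shows "quad_form m (siegel i c *\<^sub>v v) = quad_form m v"
proof -
  define s where "s = rank_ix i"
  note mult_vec = siegel_mult_vec[OF i _ v, of _ c, folded s_def]
  let ?w = "siegel i c *\<^sub>v v"
  let ?c = "\<Sum>l<s. c l * v $ l"
  have s: "s < m" and s_i: "s \<le> i" "s \<le> refl_ix i" "s = i \<or> s = refl_ix i"
    using i m_pos by (auto simp: s_def)
  have summand: "?w $ refl_ix k * ?w $ k = v $ refl_ix k * v $ k +
      (if k \<in> {..<s} then c k * v $ k * v $ refl_ix i else 0) + (if k = s then ?c * v $ refl_ix i else 0)"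
    if k: "k < m" for k
  proof -
    have w: "?w $ k = v $ k + (if k = i then ?c else 0)"
      using mult_vec[of k] k s by auto
    have w': "?w $ refl_ix k = v $ refl_ix k + (if refl_ix k = i then ?c else 0) +
        (if k < s then c k * v $ refl_ix i else 0)"
      using mult_vec[of "refl_ix k"] k by auto
    \<comment> \<open>The pair numbered \<open>s\<close> contains \<open>i\<close>, as its lower or
      its upper member; pairs below \<open>s\<close> carry the compensation and pairs above
      \<open>s\<close> are unchanged.\<close>
    consider "k < s" | "k = s" "i = k" | "k = s" "i = refl_ix k" "i \<noteq> k" | "k > s" using k i s_i by linarith
    then show ?thesis
    proof cases
      case 1
      then have "k \<noteq> i" "refl_ix k \<noteq> i" using i k s_i by auto
      then show ?thesis using 1 unfolding w w' by (simp add: algebra_simps)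
    next
      case 2
      then have "refl_ix k \<noteq> i" "refl_ix i = refl_ix k" using i k by auto
      then show ?thesis using 2 unfolding w w' by (simp add: algebra_simps)
    next
      case 3
      then have "refl_ix i = k" using i k by auto
      then show ?thesis using 3 unfolding w w' by (simp add: algebra_simps)
    next
      case 4
      then have "k \<noteq> i" "refl_ix k \<noteq> i" using i k s_i by auto
      then show ?thesis using 4 unfolding w w' by simp
    qed
  qed
  have restrict: "{..<m} \<inter> {..<s} = {..<s}" using s by auto
  have "quad_form m ?w = (\<Sum>k<m. v $ refl_ix k * v $ k +
      (if k \<in> {..<s} then c k * v $ k * v $ refl_ix i else 0) + (if k = s then ?c * v $ refl_ix i else 0))"
    unfolding quad_form_lessThan by (intro sum.cong refl summand) simp
  also have "\<dots> = quad_form m v + ?c * v $ refl_ix i + ?c * v $ refl_ix i"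
    unfolding sum.distrib sum.inter_restrict[OF finite_lessThan, symmetric] restrict
    using s by (simp add: quad_form_lessThan sum_distrib_right)
  finally show ?thesis using char_two[of "?c * v $ refl_ix i"] by (simp add: add.assoc)
qed

lemma siegel_G1:
  assumes i: "i < n"
  shows "siegel i c \<in> G1 m"
  unfolding G1_iff
proof (intro conjI)
  show "siegel i c \<in> O_plus m"
    using siegel_GL[OF i] quad_form_siegel[OF i] by (auto simp: O_plus_def)
  show "siegel i c \<in> lower_unitri n"
    using i by (auto simp: lower_unitri_def siegel_def)
  \<comment> \<open>Only \<open>i = m\<close> could reach this entry, but
    \<open>rank_ix m = m - 1\<close> and the bounds in the definition are strict.\<close>
  show "siegel i c $$ (m, m - 1) = 0"
    using i m_pos by (auto simp: siegel_def)
qed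

lemma act_siegel:
  assumes i: "i < n" and "k < n"
  shows "act_poly (siegel i c) (\<xi> k) = \<xi> k + (if k = i then \<Sum>l<rank_ix i. const (c l) * \<xi> l else 0) +
     (if refl_ix k < rank_ix i then const (c (refl_ix k)) * \<xi> (refl_ix i) else 0)"
  unfolding act_poly_simps act_var_Suc[OF siegel_GL[OF i]] siegel_inverse[OF i]
  by (rule sum_siegel[OF assms]) (simp_all add: const_add)

text \<open>A compensated coordinate \<open>k\<close> has
  \<open>refl_ix k < rank_ix i \<le> refl_ix i\<close>, hence lies above \<open>i\<close>.\<close>

lemma act_siegel_less: "k < i \<Longrightarrow> i < n \<Longrightarrow> act_poly (siegel i c) (\<xi> k) = \<xi> k"
  using act_siegel[of i k c] by auto

lemma act_siegel_same:
  "i < n \<Longrightarrow> act_poly (siegel i c) (\<xi> i) = \<xi> i + (\<Sum>l<rank_ix i. const (c l) * \<xi> l)"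
  using act_siegel[of i i c] by auto

lemma siegel_orbit: "i < n \<Longrightarrow> (\<lambda>c. act_poly (siegel i c) (\<xi> i)) ` UNIV = (\<lambda>v. \<xi> i + v) ` var_span (rank_ix i)"
  by (auto simp: act_siegel_same var_span_iff image_iff)

section \<open>The matrix \<open>L\<close> as a transposition of the two middle coordinates\<close>

definition swap_ix :: "nat \<Rightarrow> nat" where
  "swap_ix k = (if k = m - 1 then m else if k = m then m - 1 else k)"

lemma L_mat_eq: "L_mat m = mat n n (\<lambda>(i, j). if j = swap_ix i then 1 else (0 :: 'a))"
proof (rule eq_matI)
  fix i j assume "i < dim_row (mat n n (\<lambda>(i, j). if j = swap_ix i then 1 else (0 :: 'a)))"
    "j < dim_col (mat n n (\<lambda>(i, j). if j = swap_ix i then 1 else (0 :: 'a)))"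
  then have ij: "i < n" "j < n" by auto
  consider "i < m - 1" | "i = m - 1" | "i = m" | "i > m" by linarith
  then show "L_mat m $$ (i, j) = mat n n (\<lambda>(i, j). if j = swap_ix i then 1 else (0 :: 'a)) $$ (i, j)"
    by cases (use ij m_pos in \<open>auto simp: L_mat_def Let_def antidiag_mat_def swap_ix_def\<close>)
qed (use m_pos in \<open>auto simp: L_mat_def Let_def antidiag_mat_def\<close>)

lemma sum_L_mat:
  fixes f :: "'a \<Rightarrow> 'b::comm_ring_1"
  assumes "k < n" "f 0 = 0" "f 1 = 1"
  shows "(\<Sum>l<n. f (L_mat m $$ (k, l)) * x l) = x (swap_ix k)"
proof -
  have "swap_ix k < n" using assms m_pos by (auto simp: swap_ix_def)
  have "(\<Sum>l<n. f (L_mat m $$ (k, l)) * x l) = (\<Sum>l<n. if l = swap_ix k then x l else 0)"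
    using assms unfolding L_mat_eq by (intro sum.cong refl) auto
  then show ?thesis using \<open>swap_ix k < n\<close> by simp
qed

lemma L_mat_carrier: "(L_mat m :: 'a mat) \<in> carrier_mat n n"
  by (simp add: L_mat_eq)

lemma L_mat_square: "L_mat m * L_mat m = (1\<^sub>m n :: 'a mat)"
proof (rule eq_matI)
  fix k j assume "k < dim_row (1\<^sub>m n :: 'a mat)" "j < dim_col (1\<^sub>m n :: 'a mat)"
  then have kj: "k < n" "j < n" by auto
  then have "swap_ix k < n" using m_pos by (auto simp: swap_ix_def)
  have "(L_mat m * L_mat m) $$ (k, j) = (\<Sum>l<n. L_mat m $$ (k, l) * L_mat m $$ (l, j) :: 'a)"
    using carrier_matD[OF L_mat_carrier] kj by (simp add: scalar_prod_def lessThan_atLeast0)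
  also have "\<dots> = L_mat m $$ (swap_ix k, j)" using sum_L_mat[OF kj(1), of "\<lambda>a. a"] by simp
  also have "\<dots> = 1\<^sub>m n $$ (k, j)"
    using kj \<open>swap_ix k < n\<close> by (auto simp: L_mat_eq swap_ix_def)
  finally show "(L_mat m * L_mat m) $$ (k, j) = (1\<^sub>m n :: 'a mat) $$ (k, j)" .
qed (simp_all add: L_mat_eq)

lemma L_mat_GL: "L_mat m \<in> carrier (GL n :: 'a mat monoid)"
  using L_mat_carrier L_mat_square by (auto simp: carrier_GL)

text \<open>The swap exchanges the two factors of a single hyperbolic product.\<close>

lemma L_mat_O_plus: "(L_mat m :: 'a mat) \<in> O_plus m"
  unfolding O_plus_def
proof (intro CollectI conjI ballI)
  fix v :: "'a vec" assume v: "v \<in> carrier_vec n"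
  have Lv: "(L_mat m *\<^sub>v v) $ k = v $ swap_ix k" if "k < n" for k
    using sum_L_mat[OF that, of "\<lambda>a. a" "\<lambda>l. v $ l"] that v carrier_matD[OF L_mat_carrier]
    by (simp add: scalar_prod_def lessThan_atLeast0)
  show "quad_form m (L_mat m *\<^sub>v v) = quad_form m v"
    unfolding quad_form_lessThan
  proof (intro sum.cong refl)
    fix k assume k: "k \<in> {..<m}"
    show "(L_mat m *\<^sub>v v) $ refl_ix k * (L_mat m *\<^sub>v v) $ k = v $ refl_ix k * v $ k"
    proof (cases "k = m - 1")
      case True
      then have "refl_ix k = m" using m_pos by simp
      then show ?thesis using True m_pos by (simp add: Lv swap_ix_def mult.commute)
    next
      case False
      then have "swap_ix k = k" "swap_ix (refl_ix k) = refl_ix k" using k by (auto simp: swap_ix_def)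
      then show ?thesis using k by (simp add: Lv)
    qed
  qed
qed (rule L_mat_GL)

lemma act_L_mat: "k < n \<Longrightarrow> act_poly (L_mat m) (\<xi> k) = \<xi> (swap_ix k)"
  unfolding act_poly_simps act_var_Suc[OF L_mat_GL]
    GL_inverse_unique[OF L_mat_GL L_mat_carrier L_mat_square]
  by (rule sum_L_mat) simp_all

section \<open>Action on the products \<open>P_s\<close> and on orbit products\<close>

lemma act_var_span_subset:
  assumes "\<And>l. l < s \<Longrightarrow> act_poly g (\<xi> l) \<in> var_span s"
  shows "act_poly g ` var_span s \<subseteq> var_span s"
  unfolding image_subset_iff
proof (intro ballI)
  fix v :: "'a mpoly" assume "v \<in> var_span s"
  then obtain c where "v = (\<Sum>l<s. const (c l) * \<xi> l)" unfolding var_span_iff by blast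
  then show "act_poly g v \<in> var_span s"
    by (auto simp: act_poly_sum act_poly_simps(2,3) intro!: var_span_sum var_span_scale assms)
qed

text \<open>An injective map of the finite set \<open>W_s\<close> into itself permutes the
  factors.\<close>

lemma act_span_prod:
  assumes g: "g \<in> carrier (GL n)" and s: "s \<le> n"
    and stable: "\<And>l. l < s \<Longrightarrow> act_poly g (\<xi> l) \<in> var_span s"
  shows "act_poly g (span_prod s t) = span_prod s (act_poly g t)"
proof -
  have "inj_on (act_poly g) (var_span s)"
    using act_poly_inj_on[OF g] var_span_polys[of s] polys_mono[OF s] by (meson inj_on_subset subset_trans)
  then have "bij_betw (act_poly g) (var_span s) (var_span s)"
    using endo_inj_surj[OF finite_var_span act_var_span_subset[OF stable]] by (auto simp: bij_betw_def)
  then show ?thesis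
    unfolding span_prod_def act_poly_prod act_poly_simps
    using prod.reindex_bij_betw[of "act_poly g" _ _ "\<lambda>v. act_poly g t + v"] by blast
qed

text \<open>The orbit is exactly the coset of \<open>W_s\<close>: \<open>act_var_G1\<close> bounds
  it from above and Siegel transformations reach every element. For \<open>i > m\<close> that upper
  bound is only the larger space \<open>W_i\<close>.\<close>

lemma orbit_prod_eq:
  assumes i: "i \<le> m"
  shows "orbit_prod m (Suc i) = span_prod (rank_ix i) (\<xi> i)"
proof -
  have i_n: "i < n" using i m_pos by simp
  have rank: "rank_ix i = (if i = m then m - 1 else i)" using i m_pos by auto
  have "(\<lambda>g. act_poly g (\<xi> i)) ` G1 m = (\<lambda>v. \<xi> i + v) ` var_span (rank_ix i)"
  proof
    show "(\<lambda>g. act_poly g (\<xi> i)) ` G1 m \<subseteq> (\<lambda>v. \<xi> i + v) ` var_span (rank_ix i)"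
    proof (rule image_subsetI)
      fix g :: "'a mat" assume "g \<in> G1 m"
      from act_var_G1[OF this i_n] show "act_poly g (\<xi> i) \<in> (\<lambda>v. \<xi> i + v) ` var_span (rank_ix i)"
        unfolding rank by (metis imageI)
    qed
    show "(\<lambda>v. \<xi> i + v) ` var_span (rank_ix i) \<subseteq> (\<lambda>g. act_poly g (\<xi> i)) ` G1 m"
      unfolding siegel_orbit[OF i_n, symmetric] using siegel_G1[OF i_n] by blast
  qed
  then show ?thesis by (simp add: orbit_prod_def span_prod_def prod.reindex)
qed

lemma act_G1_var_span:
  assumes g: "(g :: 'a mat) \<in> G1 m" and "l < s" "s \<le> n"
  shows "act_poly g (\<xi> l) \<in> var_span s"
proof -
  obtain w where w: "w \<in> var_span (if l = m then m - 1 else l)" "act_poly g (\<xi> l) = \<xi> l + w"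
    by (rule act_var_G1[OF g, of l]) (use assms in auto)
  have mono: "var_span a \<subseteq> (var_span s :: 'a mpoly set)" if "a \<le> s" for a
    using that
    by (intro subsetI) (auto simp: var_span_iff[of _ a] intro!: var_span_sum var_span_scale Var_in_var_span)
  have "(if l = m then m - 1 else l) \<le> s" using assms(2) by auto
  then have "w \<in> var_span s" using w(1) mono by blast
  then show ?thesis using w(2) assms(2) by (auto intro: var_span_add Var_in_var_span)
qed

lemma act_orbit_prod_G1:
  assumes g: "(g :: 'a mat) \<in> G1 m" and i: "i \<le> m"
  shows "act_poly g (orbit_prod m (Suc i)) = orbit_prod m (Suc i)"
proof -
  have i_n: "i < n" "rank_ix i \<le> n" using i m_pos by auto
  have gG: "g \<in> carrier (GL n)" using g G1_carrier by blast
  have rank: "rank_ix i = (if i = m then m - 1 else i)" using i m_pos by auto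
  obtain w where "w \<in> var_span (rank_ix i)" "act_poly g (\<xi> i) = \<xi> i + w"
    using act_var_G1[OF g i_n(1)] unfolding rank by blast
  moreover have "act_poly g (span_prod (rank_ix i) (\<xi> i)) = span_prod (rank_ix i) (act_poly g (\<xi> i))"
    using act_G1_var_span[OF g _ i_n(2)] by (rule act_span_prod[OF gG i_n(2)])
  ultimately show ?thesis
    unfolding orbit_prod_eq[OF i] by (simp only: span_prod_shift)
qed

text \<open>\<open>W_s\<close> involves only variables before the two middle ones, which
  \<open>L\<close> fixes; hence only the argument of \<open>P_s\<close> is swapped.\<close>

lemma act_orbit_prod_L:
  assumes i: "i \<le> m"
  shows "act_poly (L_mat m) (orbit_prod m (Suc i)) = (orbit_prod m (Suc (swap_ix i)) :: 'a mpoly)"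
proof -
  have i_n: "i < n" "rank_ix i \<le> n" and swap: "swap_ix i \<le> m" using i m_pos by (auto simp: swap_ix_def)
  have rank: "rank_ix (swap_ix i) = rank_ix i" using i m_pos by (auto simp: swap_ix_def)
  have "act_poly (L_mat m) (\<xi> l) \<in> var_span (rank_ix i)" if "l < rank_ix i" for l
  proof -
    have "swap_ix l = l" "l < n" using that i m_pos by (auto simp: swap_ix_def)
    then show ?thesis using that by (simp add: act_L_mat Var_in_var_span)
  qed
  then show ?thesis
    unfolding orbit_prod_eq[OF i] orbit_prod_eq[OF swap] rank
    by (subst act_span_prod[OF L_mat_GL i_n(2)]) (simp_all add: act_L_mat i_n)
qed

end

section \<open>Invariants\<close>

lemma sum_square_split:
  fixes F :: "nat \<Rightarrow> nat \<Rightarrow> 'b::comm_monoid_add"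
  shows "(\<Sum>a\<le>s. \<Sum>b\<le>s. F a b) = (\<Sum>a\<le>s. F a a) + (\<Sum>a\<le>s. \<Sum>b<a. F a b + F b a)"
proof (induction s)
  case (Suc s)
  have "(\<Sum>a\<le>Suc s. \<Sum>b\<le>Suc s. F a b) =
      (\<Sum>a\<le>s. \<Sum>b\<le>s. F a b) + ((\<Sum>b\<le>s. F (Suc s) b) + (\<Sum>a\<le>s. F a (Suc s))) + F (Suc s) (Suc s)"
    by (simp add: sum.distrib add_ac)
  then show ?case
    unfolding Suc.IH by (simp add: sum.distrib lessThan_Suc_atMost add_ac)
qed simp

lemma to_rat_in_subfield:
  assumes "p \<in> polys i" and K: "is_subfield K" and "\<And>c. to_rat (const c) \<in> K"
    and "\<And>l. l < i \<Longrightarrow> to_rat (Var (Suc l)) \<in> K"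
  shows "to_rat p \<in> K"
  using assms(1)
proof (induction rule: polys_induct)
  case (Var j)
  then show ?case using assms(4)[of "j - 1"] by (cases j) auto
qed (simp_all add: assms(3) to_rat_add to_rat_mult subfield_add[OF K] subfield_mult[OF K])

lemma span_prod_in_polys: "s \<le> k \<Longrightarrow> t \<in> polys k \<Longrightarrow> span_prod s t \<in> polys k"
  unfolding span_prod_def using var_span_polys[of s] polys_mono[of s k]
  by (auto intro!: polys_prod polys_add)

lemma invariant_to_rat:
  assumes H: "H \<subseteq> carrier (GL n)" and "p \<in> polys n" and "\<And>g. g \<in> H \<Longrightarrow> act_poly g p = p"
  shows "to_rat p \<in> invariant_field n H"
  using assms act_rat_to_rat[of _ n p] by (auto simp: invariant_field_def to_rat_in_rat_funs)

context even_orthogonal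
begin

text \<open>
  This is \<open>h_1\<close> evaluated at \<open>(P(x_1), \<dots>, P(x_{2m}))\<close> for the additive polynomial \<open>P\<close>. Expanding
  \<open>P\<close> and pairing the terms for \<open>(a, b)\<close> and \<open>(b, a)\<close>, only Frobenius powers of
  \<open>h_1, \<dots>, h_{s+1}\<close> remain.
\<close>

lemma quad_span_prod:
  assumes c: "\<And>t. span_prod s t = (\<Sum>a\<le>s. c a * t ^ (q ^ a))"
  shows "(\<Sum>l<m. span_prod s (\<xi> l) * span_prod s (\<xi> (refl_ix l))) =
    (\<Sum>a\<le>s. c a * c a * h_poly q m 1 ^ (q ^ a)) +
    (\<Sum>a\<le>s. \<Sum>b<a. c a * c b * h_poly q m (a - b + 1) ^ (q ^ b))"
proof -
  define B where "B a b = (\<Sum>l<m. \<xi> l ^ (q ^ a) * \<xi> (refl_ix l) ^ (q ^ b))" for a b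
  have diag: "B a a = h_poly q m 1 ^ (q ^ a)" for a
    unfolding B_def h_poly_1 frobenius_sum by (simp add: power_mult_distrib mult.commute)
  have off: "B a b + B b a = h_poly q m (a - b + 1) ^ (q ^ b)" if "b < a" for a b
  proof -
    \<comment> \<open>\<open>h_{a-b+1}\<close> has exponents \<open>q ^ (a - b)\<close> and 1;
      raising it to the power \<open>q ^ b\<close> produces the pair \<open>q ^ a\<close>,
      \<open>q ^ b\<close>.\<close>
    have "q ^ (a - b) * q ^ b = q ^ a" using that by (simp flip: power_add)
    then have pow: "(x ^ (q ^ (a - b))) ^ (q ^ b) = x ^ (q ^ a)" for x :: "'a mpoly"
      by (simp flip: power_mult)
    have ab: "a - b + 1 \<noteq> 1" "a - b + 1 - 1 = a - b" using that by auto
    have "h_poly q m (a - b + 1) ^ (q ^ b) = (\<Sum>l<m.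
        \<xi> (refl_ix l) ^ (q ^ a) * \<xi> l ^ (q ^ b) + \<xi> (refl_ix l) ^ (q ^ b) * \<xi> l ^ (q ^ a))"
      unfolding h_poly_2[OF ab(1)] ab(2) frobenius_sum frobenius power_mult_distrib pow ..
    then show ?thesis by (simp add: B_def sum.distrib mult.commute add.commute)
  qed
  have "(\<Sum>l<m. span_prod s (\<xi> l) * span_prod s (\<xi> (refl_ix l))) =
      (\<Sum>l<m. \<Sum>a\<le>s. \<Sum>b\<le>s. c a * c b * (\<xi> l ^ (q ^ a) * \<xi> (refl_ix l) ^ (q ^ b)))"
    unfolding c sum_product by (intro sum.cong refl) (simp add: mult_ac)
  also have "\<dots> = (\<Sum>a\<le>s. \<Sum>b\<le>s. c a * c b * B a b)"
    unfolding B_def sum_distrib_left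
    by (subst sum.swap) (intro sum.cong refl sum.swap)
  also have "\<dots> = (\<Sum>a\<le>s. c a * c a * B a a) + (\<Sum>a\<le>s. \<Sum>b<a. c a * c b * (B a b + B b a))"
    unfolding sum_square_split by (simp add: algebra_simps)
  also have "\<dots> = (\<Sum>a\<le>s. c a * c a * h_poly q m 1 ^ (q ^ a)) +
      (\<Sum>a\<le>s. \<Sum>b<a. c a * c b * h_poly q m (a - b + 1) ^ (q ^ b))"
    by (intro arg_cong2[of _ _ _ _ "(+)"] sum.cong refl) (simp_all only: diag off lessThan_iff)
  finally show ?thesis .
qed

section \<open>The tower of fields and descent along it\<close>

definition G1_gens :: "'a mpoly set" where
  "G1_gens = orbit_prod m ` {1..m + 1} \<union> h_poly q m ` {1..m - 1}"

text \<open>The \<open>K_i\<close> of the overview; the next variable to be adjoined is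
  \<open>\<xi> i\<close>.\<close>

definition stage :: "nat \<Rightarrow> 'a mpoly fract set" where
  "stage i = field_gen (to_rat ` (range const \<union> G1_gens \<union> \<xi> ` {..<i}))"

lemma subfield_stage: "is_subfield (stage i)"
  unfolding stage_def by (rule subfield_field_gen)

lemma
  shows const_in_stage: "to_rat (const c) \<in> stage i"
    and gens_in_stage: "p \<in> G1_gens \<Longrightarrow> to_rat p \<in> stage i"
    and var_in_stage: "l < i \<Longrightarrow> to_rat (\<xi> l) \<in> stage i"
  unfolding stage_def by (rule subsetD[OF field_gen_incl], blast)+

lemma polys_in_stage: "p \<in> polys i \<Longrightarrow> to_rat p \<in> stage i"
  by (rule to_rat_in_subfield[OF _ subfield_stage const_in_stage var_in_stage])

lemma rat_funs_stage: "rat_funs n \<subseteq> stage n"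
  unfolding rat_funs_iff using subfield_divide[OF subfield_stage] polys_in_stage
  by (auto simp: rat_funs_iff)

lemma orbit_prod_in_polys: "i \<in> {1..m + 1} \<Longrightarrow> orbit_prod m i \<in> (polys n :: 'a mpoly set)"
  using orbit_prod_eq[of "i - 1"] m_pos
  by (auto intro!: span_prod_in_polys Var_in_polys)

lemma G1_gens_polys: "G1_gens \<subseteq> polys n"
  using orbit_prod_in_polys h_poly_in_polys by (auto simp: G1_gens_def)

lemma act_G1_gens: "g \<in> G1 m \<Longrightarrow> p \<in> G1_gens \<Longrightarrow> act_poly g p = p"
  unfolding G1_gens_def
proof (elim UnE imageE)
  fix i assume "g \<in> G1 m" "p = orbit_prod m i" "i \<in> {1..m + 1}"
  then show "act_poly g p = p" using act_orbit_prod_G1[of g "i - 1"] by (cases i) auto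
next
  fix j assume "g \<in> G1 m" "p = h_poly q m j"
  then show "act_poly g p = p" using act_h_poly by (simp add: G1_iff)
qed

lemma stage_rat_funs: "i \<le> n \<Longrightarrow> stage i \<subseteq> rat_funs n"
  unfolding stage_def using G1_gens_polys
  by (intro field_gen_minimal[OF subfield_rat_funs])
    (auto intro!: to_rat_in_rat_funs Var_in_polys)

lemma stage_relation:
  assumes i: "i < n"
  shows "to_rat (span_prod (rank_ix i) (\<xi> i)) \<in> stage i"
proof (cases "i \<le> m")
  case True
  then have "span_prod (rank_ix i) (\<xi> i) \<in> G1_gens"
    using orbit_prod_eq[OF True] by (auto simp: G1_gens_def intro!: image_eqI[of _ _ "Suc i"])
  then show ?thesis by (rule gens_in_stage)
next
  case False
  define e where "e = refl_ix i"
  \<comment> \<open>The bound \<open>e + 2 \<le> m\<close> keeps all indices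
    \<open>a - b + 1 \<le> e + 1\<close> of the forms within \<open>{1..m - 1}\<close>.\<close>
  have e: "e + 2 \<le> m" "rank_ix i = e" "refl_ix e = i" "e < i" "e < m" using False i by (auto simp: e_def)
  obtain c :: "nat \<Rightarrow> 'a mpoly" where c: "\<And>a. c a \<in> polys e"
    and P: "\<And>t. span_prod e t = (\<Sum>a\<le>e. c a * t ^ (q ^ a))"
    using span_prod_additive[of e] by metis
  let ?P = "span_prod e :: 'a mpoly \<Rightarrow> 'a mpoly"
  define H where "H = (\<Sum>l<m. ?P (\<xi> l) * ?P (\<xi> (refl_ix l)))"
  define R where "R = (\<Sum>l\<in>{..<m} - {e}. ?P (\<xi> l) * ?P (\<xi> (refl_ix l)))"
  note K = subfield_stage[of i]
  have c_stage: "to_rat (c a) \<in> stage i" for a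
    using c[of a] polys_mono[of e i] e(4) polys_in_stage by auto
  have h_stage: "to_rat (h_poly q m j) \<in> stage i" if "j \<in> {1..m - 1}" for j
    using that by (intro gens_in_stage) (simp add: G1_gens_def)
  have "to_rat H \<in> stage i"
    unfolding H_def quad_span_prod[OF P] to_rat_add to_rat_sum to_rat_mult to_rat_power using e(1)
    by (intro subfield_add subfield_sum subfield_mult subfield_power K c_stage h_stage) auto
  moreover have "to_rat R \<in> stage i"
    unfolding R_def to_rat_sum
  proof (intro subfield_sum K)
    fix l assume l: "l \<in> {..<m} - {e}"
    show "to_rat (?P (\<xi> l) * ?P (\<xi> (refl_ix l))) \<in> stage i"
    proof (cases "l < e")
      case True
      then have "?P (\<xi> l) = 0" unfolding span_prod_eq_0_iff by (rule Var_in_var_span)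
      then show ?thesis by (simp add: subfield_zero[OF K])
    next
      case False
      \<comment> \<open>Beyond the pair of \<open>e\<close> both partners precede \<open>i\<close>,
        so these products are polynomials in variables already adjoined.\<close>
      then have "l < i" "refl_ix l < i" using l e i by (auto simp: e_def)
      then have "?P (\<xi> l) \<in> polys i" "?P (\<xi> (refl_ix l)) \<in> polys i"
        using e(4) by (auto intro!: span_prod_in_polys Var_in_polys)
      then show ?thesis by (intro polys_in_stage polys_mult)
    qed
  qed
  moreover have "to_rat (?P (\<xi> e)) \<in> stage i"
    using e(4) by (intro polys_in_stage span_prod_in_polys Var_in_polys) auto
  \<comment> \<open>\<open>P_e\<close> vanishes exactly on the span of \<open>\<xi> 0\<close> to
    \<open>\<xi> (e - 1)\<close>, so \<open>\<xi> e\<close> is the first variable that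
    survives.\<close>
  moreover have nz: "?P (\<xi> e) \<noteq> 0"
    unfolding span_prod_eq_0_iff by (rule Var_notin_var_span) simp
  have "H = ?P (\<xi> e) * ?P (\<xi> i) + R"
    unfolding H_def R_def using e(3,5) by (subst sum.remove[of _ e]) simp_all
  then have "to_rat H = to_rat (?P (\<xi> e)) * to_rat (?P (\<xi> i)) + to_rat R"
    by (simp add: to_rat_add to_rat_mult)
  then have "to_rat (?P (\<xi> i)) = (to_rat H - to_rat R) / to_rat (?P (\<xi> e))"
    using nz by simp
  ultimately show ?thesis
    unfolding e(2) by (simp only: subfield_diff[OF K] subfield_divide[OF K])
qed

lemma stage_descent:
  assumes i: "i < n" and f: "f \<in> stage (Suc i)" and inv: "\<And>g. g \<in> G1 m \<Longrightarrow> act_rat g f = f"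
  shows "f \<in> stage i"
proof -
  let ?x = "to_rat (\<xi> i)"
  let ?W = "var_span (rank_ix i) :: 'a mpoly set"
  let ?K = "stage i"
  let ?N = "span_prod (rank_ix i) (\<xi> i)"
  define A where "A = (\<Prod>v\<in>?W. [:to_rat v, 1:])"
  note K = subfield_stage[of i]
  have W_pos: "card ?W > 0" using var_span_0 by (auto simp: card_gt_0_iff finite_var_span)
  have A_deg: "Polynomial.degree A = card ?W" by (simp add: A_def degree_prod_sum_eq)
  \<comment> \<open>\<open>A\<close> is \<open>P_s\<close> as a univariate polynomial; its
    coefficients involve only variables before \<open>\<xi> i\<close>, and the subtracted constant
    lies in \<open>stage i\<close> by \<open>stage_relation\<close>.\<close>
  define p where "p = A - [:to_rat ?N:]"
  have "Polynomial.degree p = Polynomial.degree A"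
    unfolding p_def diff_conv_add_uminus using A_deg W_pos by (intro degree_add_eq_left) simp
  then have deg: "Polynomial.degree p = card ?W" using A_deg by simp
  have W_stage: "to_rat v \<in> ?K" if "v \<in> ?W" for v
    using that var_span_polys[of "rank_ix i"] polys_mono[of "rank_ix i" i] polys_in_stage by auto
  show ?thesis
  proof (rule fixed_in_base_field[OF K, where p = p and M = "rat_funs n" and x = ?x
        and \<Phi> = "range (\<lambda>c. act_rat (siegel i c))"])
    show "coeffs_in ?K p"
      unfolding p_def A_def
      by (intro coeffs_in_diff[OF K] coeffs_in_prod[OF K] coeffs_in_const[OF K] stage_relation[OF i])
        (simp add: coeffs_in_pCons coeffs_in_0[OF K] W_stage subfield_one[OF K])
    show "p \<noteq> 0" using deg W_pos by auto
    show "poly p ?x = 0"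
      by (simp add: p_def A_def poly_prod span_prod_def to_rat_prod to_rat_add add.commute)
    have "stage (Suc i) \<subseteq> field_gen (insert ?x ?K)"
      unfolding stage_def[of "Suc i"]
    proof (rule field_gen_mono)
      have "insert ?x ?K \<subseteq> field_gen (insert ?x ?K)" by (rule field_gen_incl)
      moreover have "to_rat ` (range const \<union> G1_gens \<union> \<xi> ` {..<Suc i}) \<subseteq> insert ?x ?K"
        by (auto simp: lessThan_Suc const_in_stage gens_in_stage var_in_stage)
      ultimately show "to_rat ` (range const \<union> G1_gens \<union> \<xi> ` {..<Suc i}) \<subseteq> field_gen (insert ?x ?K)"
        by blast
    qed
    then show "f \<in> field_gen (insert ?x ?K)" using f by blast
    show "is_subfield (rat_funs n :: 'a mpoly fract set)" by (rule subfield_rat_funs)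
    show "?K \<subseteq> rat_funs n" using i by (intro stage_rat_funs) simp
    show "?x \<in> rat_funs n" using i by (intro to_rat_in_rat_funs Var_in_polys) simp
    fix \<phi> assume "\<phi> \<in> range (\<lambda>c. act_rat (siegel i c))"
    then obtain c where \<phi>: "\<phi> = act_rat (siegel i c)" by blast
    show "field_hom_on (rat_funs n) \<phi>" unfolding \<phi> by (rule act_rat_hom[OF siegel_GL[OF i]])
    show "\<phi> f = f" unfolding \<phi> by (rule inv[OF siegel_G1[OF i]])
    have GL1: "{siegel i c} \<subseteq> carrier (GL n)" using siegel_GL[OF i] by simp
    have "?K \<subseteq> invariant_field n {siegel i c}"
      unfolding stage_def
    proof (rule field_gen_minimal[OF subfield_fixed[OF GL1]], rule image_subsetI)
      fix p :: "'a mpoly" assume p: "p \<in> range const \<union> G1_gens \<union> \<xi> ` {..<i}"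
      have "p \<in> polys n" using p G1_gens_polys i by (auto intro!: Var_in_polys)
      moreover have "act_poly (siegel i c) p = p"
        using p act_G1_gens[OF siegel_G1[OF i]] act_siegel_less[OF _ i] by (auto simp: act_poly_simps(3))
      ultimately show "to_rat p \<in> invariant_field n {siegel i c}"
        using invariant_to_rat[OF GL1] by blast
    qed
    then show "\<phi> k = k" if "k \<in> ?K" for k using that by (auto simp: \<phi> invariant_field_def)
  next
    \<comment> \<open>The conjugates are the elements of the coset of \<open>W_s\<close> through
      \<open>\<xi> i\<close>, as many as the degree of \<open>p\<close>.\<close>
    have "(\<lambda>\<phi>. \<phi> ?x) ` range (\<lambda>c. act_rat (siegel i c)) =
        to_rat ` ((\<lambda>c. act_poly (siegel i c) (\<xi> i)) ` UNIV)"
      using i by (simp add: image_image act_rat_to_rat[OF siegel_GL[OF i]] Var_in_polys)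
    also have "card \<dots> = card ?W"
      unfolding siegel_orbit[OF i] by (simp add: card_image inj_on_def)
    finally show "Polynomial.degree p \<le> card ((\<lambda>\<phi>. \<phi> ?x) ` range (\<lambda>c. act_rat (siegel i c)))"
      by (simp add: deg)
  qed
qed

lemma G1_invariants: "invariant_field n (G1 m) \<subseteq> stage 0"
proof
  fix f assume f: "f \<in> invariant_field n (G1 m :: 'a mat set)"
  then have inv: "act_rat g f = f" if "g \<in> G1 m" for g using that by (simp add: invariant_field_def)
  have "f \<in> stage (n - k)" if "k \<le> n" for k
    using that
  proof (induction k)
    case 0
    then show ?case using f rat_funs_stage by (auto simp: invariant_field_def)
  next
    case (Suc k)
    have "Suc (n - Suc k) = n - k" using Suc.prems by linarith
    then have "f \<in> stage (Suc (n - Suc k))" using Suc by simp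
    moreover have "n - Suc k < n" using m_pos by simp
    ultimately show ?case using inv stage_descent by blast
  qed
  from this[of n] show "f \<in> stage 0" by simp
qed

section \<open>From \<open>G_1\<close> to \<open>G\<close>: the quadratic step\<close>

definition G_gens :: "'a mpoly set" where
  "G_gens = orbit_prod m ` {1..m - 1} \<union>
     {orbit_prod m m + orbit_prod m (m + 1), orbit_prod m m * orbit_prod m (m + 1)} \<union>
     h_poly q m ` {1..m - 1}"

lemma orbit_prod_m:
  "orbit_prod m m = (span_prod (m - 1) (\<xi> (m - 1)) :: 'a mpoly)"
  "orbit_prod m (m + 1) = (span_prod (m - 1) (\<xi> m) :: 'a mpoly)"
proof -
  have "rank_ix (m - 1) = m - 1" "rank_ix m = m - 1" using m_pos by auto
  then show "orbit_prod m m = (span_prod (m - 1) (\<xi> (m - 1)) :: 'a mpoly)"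
    "orbit_prod m (m + 1) = (span_prod (m - 1) (\<xi> m) :: 'a mpoly)"
    using orbit_prod_eq[of "m - 1"] orbit_prod_eq[of m] m_pos by simp_all
qed

text \<open>Supplies the second conjugate in the final descent. By additivity and characteristic 2,
  equality would put the sum of the two middle variables into \<open>W_{m-1}\<close>, a space of
  polynomials in earlier variables.\<close>

lemma orbit_prod_m_neq: "orbit_prod m m \<noteq> (orbit_prod m (m + 1) :: 'a mpoly)"
proof
  let ?P = "span_prod (m - 1) :: 'a mpoly \<Rightarrow> 'a mpoly"
  assume "orbit_prod m m = (orbit_prod m (m + 1) :: 'a mpoly)"
  then have eq: "?P (\<xi> (m - 1)) = ?P (\<xi> m)" unfolding orbit_prod_m .
  obtain c where "\<And>t. ?P t = (\<Sum>a\<le>m - 1. c a * t ^ (q ^ a))" using span_prod_additive by metis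
  then have "?P (\<xi> (m - 1) + \<xi> m) = ?P (\<xi> (m - 1)) + ?P (\<xi> m)"
    by (simp only: frobenius distrib_left sum.distrib)
  also have "\<dots> = 0" unfolding eq by (rule mpoly_char_two)
  finally have "\<xi> (m - 1) + \<xi> m \<in> polys m"
    unfolding span_prod_eq_0_iff using var_span_polys[of "m - 1"] polys_mono[of "m - 1" m] by auto
  moreover have "\<xi> (m - 1) \<in> polys m" using m_pos by (intro Var_in_polys) simp
  ultimately have "(\<xi> (m - 1) + \<xi> m) - \<xi> (m - 1) \<in> polys m" by (rule polys_diff)
  then show False using Var_notin_polys[of m m, where 'a = 'a] by simp
qed

lemma act_L_orbit_prod:
  "i \<in> {1..m - 1} \<Longrightarrow> act_poly (L_mat m) (orbit_prod m i) = (orbit_prod m i :: 'a mpoly)"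
  "act_poly (L_mat m) (orbit_prod m m) = (orbit_prod m (m + 1) :: 'a mpoly)"
  "act_poly (L_mat m) (orbit_prod m (m + 1)) = (orbit_prod m m :: 'a mpoly)"
proof -
  have swap: "swap_ix (m - 1) = m" "swap_ix m = m - 1" by (auto simp: swap_ix_def)
  show "act_poly (L_mat m) (orbit_prod m i) = (orbit_prod m i :: 'a mpoly)" if "i \<in> {1..m - 1}"
  proof -
    have "swap_ix (i - 1) = i - 1" using that by (auto simp: swap_ix_def)
    then show ?thesis using act_orbit_prod_L[of "i - 1"] that by (cases i) auto
  qed
  show "act_poly (L_mat m) (orbit_prod m m) = (orbit_prod m (m + 1) :: 'a mpoly)"
    using act_orbit_prod_L[of "m - 1"] m_pos unfolding swap by simp
  show "act_poly (L_mat m) (orbit_prod m (m + 1)) = (orbit_prod m m :: 'a mpoly)"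
    using act_orbit_prod_L[of m] m_pos unfolding swap by simp
qed

lemma G_gens_cases:
  assumes "p \<in> G_gens"
  obtains i where "i \<in> {1..m - 1}" "p = orbit_prod m i"
  | "p = orbit_prod m m + orbit_prod m (m + 1)"
  | "p = orbit_prod m m * orbit_prod m (m + 1)"
  | j where "p = h_poly q m j"
  using assms unfolding G_gens_def by blast

lemma act_L_G_gens: "p \<in> G_gens \<Longrightarrow> act_poly (L_mat m) p = p"
  by (erule G_gens_cases; simp only: act_poly_simps(1,2) act_L_orbit_prod act_h_poly[OF L_mat_O_plus])
    (simp_all only: add.commute mult.commute)

lemma act_G1_G_gens:
  assumes g: "g \<in> G1 m" and "p \<in> G_gens"
  shows "act_poly g p = p"
proof -
  have orbit: "act_poly g (orbit_prod m i) = orbit_prod m i" if "i \<in> {1..m + 1}" for i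
    using act_G1_gens[OF g] that by (simp add: G1_gens_def)
  have h: "act_poly g (h_poly q m j) = h_poly q m j" for j
    using g act_h_poly by (simp add: G1_iff)
  have m: "act_poly g (orbit_prod m m) = orbit_prod m m"
    "act_poly g (orbit_prod m (m + 1)) = orbit_prod m (m + 1)"
    using m_pos by (intro orbit; simp)+
  from \<open>p \<in> G_gens\<close> show ?thesis
  proof (cases rule: G_gens_cases)
    case (1 i)
    then have "i \<in> {1..m + 1}" by auto
    then show ?thesis using orbit 1 by simp
  qed (simp_all only: act_poly_simps(1,2) m h)
qed

lemma G_gens_polys: "G_gens \<subseteq> polys n"
proof
  fix p assume "p \<in> G_gens"
  have m: "orbit_prod m m \<in> (polys n :: 'a mpoly set)" "orbit_prod m (m + 1) \<in> (polys n :: 'a mpoly set)"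
    using m_pos by (intro orbit_prod_in_polys; simp)+
  from \<open>p \<in> G_gens\<close> show "p \<in> polys n"
  proof (cases rule: G_gens_cases)
    case (1 i)
    then have "i \<in> {1..m + 1}" by auto
    then show ?thesis using orbit_prod_in_polys 1 by simp
  qed (use m in \<open>blast intro: polys_add polys_mult h_poly_in_polys\<close>)+
qed

lemma G_grp_carrier: "G_grp m \<subseteq> carrier (GL n :: 'a mat monoid)"
  unfolding G_grp_def using L_mat_GL G1_carrier
  by (intro group.generate_incl[OF group_GL]) auto

lemma act_G_gens:
  assumes "g \<in> G_grp m" and p: "p \<in> G_gens"
  shows "act_poly g p = p"
proof -
  have pn: "p \<in> polys n" using p G_gens_polys by blast
  have gen: "act_poly h p = p" "h \<in> carrier (GL n)" if "h \<in> insert (L_mat m) (G1 m)" for h :: "'a mat"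
    using that act_L_G_gens[OF p] act_G1_G_gens[OF _ p] L_mat_GL G1_carrier by auto
  have sub: "generate (GL n) (insert (L_mat m) (G1 m)) \<subseteq> carrier (GL n :: 'a mat monoid)"
    using G_grp_carrier unfolding G_grp_def .
  show ?thesis
    using assms(1) unfolding G_grp_def
  proof (induction rule: generate.induct)
    case one
    then show ?case using act_poly_one_mat[OF pn] by simp
  next
    case (incl h)
    then show ?case using gen by blast
  next
    case (inv h)
    then show ?case using gen act_poly_inverse[OF _ pn, of h] by simp
  next
    case (eng h1 h2)
    then show ?case using act_poly_mult_mat[of h1 n h2 p] sub pn by auto
  qed
qed

text \<open>One middle orbit product generates the other: it is their sum minus the first.\<close>

lemma stage_0_subset:
  "stage 0 \<subseteq> field_gen (insert (to_rat (orbit_prod m m)) (field_generated G_gens))"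
  (is "_ \<subseteq> field_gen (insert ?x ?K)")
  unfolding stage_def
proof (rule field_gen_mono, rule image_subsetI)
  fix p :: "'a mpoly" assume "p \<in> range const \<union> G1_gens \<union> \<xi> ` {..<0}"
  note F = subfield_field_gen[of "insert ?x ?K"]
  have incl: "insert ?x ?K \<subseteq> field_gen (insert ?x ?K)" by (rule field_gen_incl)
  have K: "to_rat p \<in> field_gen (insert ?x ?K)" if "p \<in> range const \<union> G_gens" for p
    using that incl field_gen_incl[of "to_rat ` (range const \<union> G_gens)"]
    unfolding field_generated_def by blast
  have x: "?x \<in> field_gen (insert ?x ?K)" using incl by blast
  have "to_rat (orbit_prod m m + orbit_prod m (m + 1)) - ?x \<in> field_gen (insert ?x ?K)"
    using K x by (intro subfield_diff[OF F]) (auto simp: G_gens_def)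
  then have y: "to_rat (orbit_prod m (m + 1)) \<in> field_gen (insert ?x ?K)"
    by (simp add: to_rat_add)
  have "p \<in> range const \<union> G_gens \<union> {orbit_prod m m, orbit_prod m (m + 1)}"
  proof -
    have "{1..m + 1} = {1..m - 1} \<union> {m, m + 1}" using m_pos by auto
    then show ?thesis
      using \<open>p \<in> range const \<union> G1_gens \<union> \<xi> ` {..<0}\<close> unfolding G1_gens_def G_gens_def by auto
  qed
  then show "to_rat p \<in> field_gen (insert ?x ?K)" using K x y by blast
qed

lemma invariant_field_G_grp: "invariant_field n (G_grp m) = field_generated G_gens"
proof
  let ?K = "field_generated G_gens"
  have K: "is_subfield ?K" unfolding field_generated_def by (rule subfield_field_gen)
  have K_incl: "to_rat p \<in> ?K" if "p \<in> range const \<union> G_gens" for p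
    using that unfolding field_generated_def by (intro subsetD[OF field_gen_incl]) blast
  show supset: "?K \<subseteq> invariant_field n (G_grp m)"
    unfolding field_generated_def
  proof (rule field_gen_minimal[OF subfield_fixed[OF G_grp_carrier]], rule image_subsetI)
    fix p :: "'a mpoly" assume p: "p \<in> range const \<union> G_gens"
    then have "p \<in> polys n" using G_gens_polys by auto
    moreover have "act_poly g p = p" if "g \<in> G_grp m" for g
      using p act_G_gens[OF that] by (auto simp: act_poly_simps(3))
    ultimately show "to_rat p \<in> invariant_field n (G_grp m)"
      by (intro invariant_to_rat[OF G_grp_carrier])
  qed
  show "invariant_field n (G_grp m) \<subseteq> ?K"
  proof
    fix f assume f: "f \<in> invariant_field n (G_grp m :: 'a mat set)"
    have G: "G1 m \<subseteq> (G_grp m :: 'a mat set)" "(L_mat m :: 'a mat) \<in> G_grp m"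
      by (auto simp: G_grp_def intro: generate.incl)
    have Lf: "act_rat (L_mat m) f = f" and "f \<in> invariant_field n (G1 m)"
      using f G by (auto simp: invariant_field_def)
    then have f0: "f \<in> stage 0" using G1_invariants by blast
    let ?x = "to_rat (orbit_prod m m) :: 'a mpoly fract"
    let ?y = "to_rat (orbit_prod m (m + 1)) :: 'a mpoly fract"
    have N_polys: "(orbit_prod m m :: 'a mpoly) \<in> polys n"
      using m_pos by (intro orbit_prod_in_polys) simp
    have Lx: "act_rat (L_mat m) ?x = ?y"
      by (simp only: act_rat_to_rat[OF L_mat_GL N_polys] act_L_orbit_prod)
    have xy: "?x \<noteq> ?y" using orbit_prod_m_neq by simp
    \<comment> \<open>The polynomial \<open>(T - x)(T - y)\<close>; its coefficients are, up to
      sign, the two symmetric generators.\<close>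
    let ?p = "[:?x * ?y, - (?x + ?y), 1:]"
    have "?x + ?y \<in> ?K" "?x * ?y \<in> ?K"
      unfolding to_rat_add[symmetric] to_rat_mult[symmetric]
      by (rule K_incl, simp add: G_gens_def)+
    then have p: "coeffs_in ?K ?p"
      unfolding coeffs_in_pCons
      by (intro conjI subfield_uminus[OF K] subfield_one[OF K] coeffs_in_0[OF K])
    \<comment> \<open>The identity and \<open>L\<close> give the two conjugates \<open>?x\<close>
      and \<open>?y\<close>, matching the degree of \<open>?p\<close>.\<close>
    show "f \<in> ?K"
    proof (rule fixed_in_base_field[OF K p, where M = "rat_funs n" and x = ?x
          and \<Phi> = "{\<lambda>x. x, act_rat (L_mat m)}"])
      show "poly ?p ?x = 0" by (simp add: algebra_simps)
      show "f \<in> field_gen (insert ?x ?K)" using f0 stage_0_subset by blast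
      show "is_subfield (rat_funs n :: 'a mpoly fract set)" by (rule subfield_rat_funs)
      show "?K \<subseteq> rat_funs n" using supset by (auto simp: invariant_field_def)
      show "?x \<in> rat_funs n" by (rule to_rat_in_rat_funs[OF N_polys])
      show "Polynomial.degree ?p \<le> card ((\<lambda>\<phi>. \<phi> ?x) ` {\<lambda>x. x, act_rat (L_mat m)})"
        using xy by (simp add: Lx)
      show "?p \<noteq> 0" by simp
      fix \<phi> assume "\<phi> \<in> {\<lambda>x. x, act_rat (L_mat m :: 'a mat)}"
      then consider "\<phi> = (\<lambda>x. x)" | "\<phi> = act_rat (L_mat m)" by blast
      then show "field_hom_on (rat_funs n) \<phi>" "\<phi> f = f" "\<And>k. k \<in> ?K \<Longrightarrow> \<phi> k = k"
        using act_rat_hom[OF L_mat_GL] Lf supset G(2)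
        by (cases; auto simp: field_hom_on_def invariant_field_def)+
    qed
  qed
qed

end

theorem theorem4p18:
  fixes q r m :: nat
  assumes "card (UNIV :: 'a::{field,finite} set) = q" and "q = 2 ^ r" and "m \<ge> 1"
  shows "(m \<ge> 2 \<longrightarrow> orbit_prod m 1 = (Var 1 :: 'a mpoly)) \<and>
    invariant_field (2 * m) (G_grp m :: 'a mat set) =
      field_generated
        (orbit_prod m ` {1..m - 1} \<union>
         {orbit_prod m m + orbit_prod m (m + 1), orbit_prod m m * orbit_prod m (m + 1)} \<union>
         h_poly q m ` {1..m - 1})"
proof -
  interpret even_orthogonal "TYPE('a)" q r m
    using assms by unfold_locales
  \<comment> \<open>\<open>W_0\<close> contains only 0, so the product has the single factor
    \<open>x_1\<close>.\<close>
  have "orbit_prod m 1 = (Var 1 :: 'a mpoly)"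
    using orbit_prod_eq[of 0] by (simp add: span_prod_def)
  then show ?thesis
    using invariant_field_G_grp unfolding G_gens_def by blast
qed

end
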